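(* Let $m\ge 1$, let $L$ be an $m$-component framed oriented link in $S^3$ (with components numbered $1,\dots,m$), let $1\le i\le m$ and let $n\ge1$ be an integer. Then $$\frac{1}{n!\,2^n}\,fr_i(L)^n=\sum_{D\in\mathcal{I}^{i}_n(m)}C_L[D],$$ where $fr_i(L)\in\mathbb{Z}$ is the framing of the $i$th component of $L$, $\mathcal{I}^{i}_n(m)$ is the set of all degree $n$ chord diagrams on $m$ circles such that all $n$ chords are on the $i$th circle (i.e. have both endpoints on it), and $C_L[D]$ denotes the coefficient of the chord diagram $D$ in the framed Kontsevich integral $Z(L)$.
   Context: Chord diagrams. A chord diagram on $m$ circles is a collection of finitely many chords (copies of the unit interval) whose endpoints are pairwise distinct points on the disjoint union of $m$ oriented circles numbered $1,\dots,m$, considered up to orientation-preserving homeomorphism preserving each circle. Its degree is its number of chords. $\mathcal{A}(m)$ is the $\mathbb{Q}$-vector space (completed by degree) generated by chord diagrams on $m$ circles modulo the 4T relation: for any three disjoint oriented arcs $p,q,r$ of the circles, $t_{pq}t_{pr}-t_{pr}t_{pq}+t_{pq}t_{qr}-t_{qr}t_{pq}=0$, where $t_{xy}t_{zw}$ denotes a diagram having, on these arcs, a chord joining $x,y$ and a chord joining $z,w$, stacked in the given order along the orientation, the four diagrams being identical elsewhere. The same definitions apply to diagrams on any oriented 1-manifold. Coefficients. $C[D](A)$ denotes the coefficient of $D$ in $A\in\mathcal{A}(m)$, and $C_L[D]:=C[D](Z(L))$. An individual coefficient is in general not well defined because of the 4T relation; a sum $\sum_{D\in\mathcal{D}}C[D]$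 is understood as the linear functional sending a chord diagram to $1$ if it lies in $\mathcal{D}$ and to $0$ otherwise, evaluated on any representative; it is well defined on $\mathcal{A}(m)$ when it vanishes on all 4T relators, which is the case for $\mathcal{D}=\mathcal{I}^{i}_n(m)$. Framed Kontsevich integral $Z$ (Le–Murakami). A framed q-tangle is a framed oriented tangle with a parenthesization on both sets of boundary points; each decomposes, under composition and juxtaposition, into elementary q-tangles: $I$ (trivial strand), $X_\pm$ (positive/negative crossing of two upward strands), $C_\pm$ (cap and cup), $\Lambda_\pm$ (change of parenthesization of trivial strands), and those obtained by reversing orientations of components. $Z$ is the multiplicative invariant with values in spaces of chord diagrams on the underlying 1-manifolds determined by: $Z(I)$ is the strand without chords; $Z(X_\pm)=\sum_{k\ge0}\frac{(\pm1)^k}{2^kk!}X_k$, where $X_k$ consists of the two crossing strands joined by $k$ parallel chords; $Z(C_\pm)=\sqrt{\nu}$; $Z(\Lambda_\pm)=\Phi^{\pm1}$ with $\Phi$ a Drinfeld associator (with the usual cabling of strands; the value on links is independent of its choice). Reversing the orientation of a strand reverses it in the diagrams and multiplies by $(-1)^{\#\text{chord endpoints on it}}$. Here $\nu=Z(U_0)\in\mathcal{A}(1)$ is the value on the $0$-framed unknot, $\nu=\chi\big(\exp_\sqcup(\sum_{n\ge1}b_{2n}W_{2n})\big)$, where $W_{2n}$ is the wheel with $2n$ univalent vertices, $b_{2n}$ is the coefficient of $x^{2n}$ in $\frac12\ln\frac{\sinh(x/2)}{x/2}$, $\exp_\sqcup$ is the exponential for disjoint union, and $\chi$ averages over all ways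 of attaching univalent vertices to the circle and then recursively applies the STU relation (a trivalent vertex adjacent to the circle is the difference of the two ways of attaching its two other legs directly to the circle) to obtain chord diagrams. *)

theory Defs
  imports
    "HOL-Computational_Algebra.Formal_Power_Series"
    "HOL-Library.Function_Algebras"
    "HOL-Library.Multiset"
begin

section \<open>Chord diagrams and the 4T relation\<close>

text \<open>
  A code describes a chord diagram on an oriented 1-manifold with numbered intervals (first
  component) and numbered circles (second component): along each interval, resp. along each circle
  from an arbitrary base point, one lists the names of the chords met, so that every chord name
  occurs exactly twice in total. Two codes give the same chord diagram iff they differ by an
  injective renaming of the chords and by moving the base points of the circles.
\<close>

type_synonym code = "nat list list \<times> nat list list"

definition endpoints :: "code \<Rightarrow> nat list" where
  "endpoints x = concat (fst x) @ concat (snd x)"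

definition codes :: "nat \<Rightarrow> nat \<Rightarrow> code set" where
  "codes p q = {x. length (fst x) = p \<and> length (snd x) = q \<and>
     (\<forall>l. count_list (endpoints x) l \<in> {0, 2})}"

definition same_diagram :: "code \<Rightarrow> code \<Rightarrow> bool" where
  "same_diagram x y \<longleftrightarrow> (\<exists>f. inj_on f (set (endpoints x)) \<and>
     fst y = map (map f) (fst x) \<and>
     list_all2 (\<lambda>v w. \<exists>r. w = rotate r (map f v)) (snd x) (snd y))"

type_synonym chord_diagram = "code set"

definition diagram :: "code \<Rightarrow> chord_diagram" where
  "diagram x = {y. same_diagram x y}"

definition chord_diagrams :: "nat \<Rightarrow> nat \<Rightarrow> chord_diagram set" where
  "chord_diagrams p q = diagram ` codes p q"

definition deg :: "chord_diagram \<Rightarrow> nat" where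
  "deg D = length (endpoints (SOME x. x \<in> D)) div 2"

text \<open>
  Elements of the degree completion of the space spanned by chord diagrams are arbitrary functions
  \<^typ>\<open>chord_diagram \<Rightarrow> rat\<close> supported on chord diagrams.

  For a 4T relator, the three arcs are marked by names P, Q, R occurring once each in the template
  x; these marks are then replaced by the endpoints of two new chords a and b.
\<close>

definition single :: "chord_diagram \<Rightarrow> chord_diagram \<Rightarrow> rat" where
  "single D = (\<lambda>E. if E = D then 1 else 0)"

definition plug :: "(nat \<Rightarrow> nat list) \<Rightarrow> code \<Rightarrow> code" where
  "plug \<sigma> = (let s = map (\<lambda>w. concat (map \<sigma> w)) in map_prod s s)"

definition four_T_relators :: "nat \<Rightarrow> nat \<Rightarrow> nat \<Rightarrow> (chord_diagram \<Rightarrow> rat) set" where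
  "four_T_relators p q n =
     {single (E [a, b] [a] [b]) - single (E [b, a] [a] [b])
        + single (E [a] [a, b] [b]) - single (E [a] [b, a] [b]) | E a b P Q R x.
      distinct [P, Q, R, a, b] \<and>
      count_list (endpoints x) P = 1 \<and> count_list (endpoints x) Q = 1 \<and>
      count_list (endpoints x) R = 1 \<and> {a, b} \<inter> set (endpoints x) = {} \<and>
      E = (\<lambda>u v w. diagram (plug ((\<lambda>l. [l])(P := u, Q := v, R := w)) x)) \<and>
      plug ((\<lambda>l. [l])(P := [a, b], Q := [a], R := [b])) x \<in> codes p q \<and>
      deg (E [a, b] [a] [b]) = n}"

definition eq_4T :: "nat \<Rightarrow> nat \<Rightarrow> (chord_diagram \<Rightarrow> rat) \<Rightarrow> (chord_diagram \<Rightarrow> rat) \<Rightarrow> bool" where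
  "eq_4T p q f g \<longleftrightarrow> (\<forall>n. (\<lambda>D. if deg D = n then f D - g D else 0)
     \<in> module.span (\<lambda>c h D. c * h D) (four_T_relators p q n))"

text \<open>
  The coset of f; these cosets are the elements of the space \<open>\<A>\<close> of p intervals and q circles,
  the space \<open>\<A>(m)\<close> being the case p = 0, q = m.
\<close>

definition coset_4T :: "nat \<Rightarrow> nat \<Rightarrow> (chord_diagram \<Rightarrow> rat) \<Rightarrow> (chord_diagram \<Rightarrow> rat) set" where
  "coset_4T p q f = {g. eq_4T p q f g}"

definition all_on_circle :: "nat \<Rightarrow> nat \<Rightarrow> nat \<Rightarrow> chord_diagram set" where
  "all_on_circle i n m = {D \<in> chord_diagrams 0 m. deg D = n \<and>
     (\<forall>x\<in>D. \<forall>j\<in>{1..m}. j \<noteq> i \<longrightarrow> snd x ! (j - 1) = [])}"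


section \<open>Graded series of terms\<close>

text \<open>
  A graded series assigns to each degree n a finite list of terms (coefficient, object), standing
  for their sum. The names of the chords in a product are kept apart by shifting those of the second
  factor by the degree k of the first one.
\<close>

type_synonym 'd series = "nat \<Rightarrow> (rat \<times> 'd) list"

definition conv :: "(nat \<Rightarrow> 'a \<Rightarrow> 'b \<Rightarrow> 'c) \<Rightarrow> 'a series \<Rightarrow> 'b series \<Rightarrow> 'c series" where
  "conv mul F G n =
     [(c * d, mul k x y). k \<leftarrow> [0..<Suc n], (c, x) \<leftarrow> F k, (d, y) \<leftarrow> G (n - k)]"

definition map_series :: "('a \<Rightarrow> 'b) \<Rightarrow> 'a series \<Rightarrow> 'b series" where
  "map_series h F n = map (map_prod id h) (F n)"

definition coeffs_of :: "code series \<Rightarrow> chord_diagram \<Rightarrow> rat" where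
  "coeffs_of F D = (\<Sum>(c, x)\<leftarrow>F (deg D). if diagram x = D then c else 0)"


section \<open>Drinfeld associators\<close>

text \<open>
  A horizontal chord diagram on N upward strands 0, ..., N - 1 is a list of pairs of strands, read
  from bottom to top; products are therefore written in the order in which one travels upwards.
\<close>

type_synonym horizontal = "(nat \<times> nat) list"

definition strand_words :: "nat \<Rightarrow> horizontal \<Rightarrow> nat list list" where
  "strand_words N ps =
     map (\<lambda>j. [k \<leftarrow> [0..<length ps]. j = fst (ps ! k) \<or> j = snd (ps ! k)]) [0..<N]"

abbreviation hmul :: "horizontal series \<Rightarrow> horizontal series \<Rightarrow> horizontal series"
    (infixl \<open>\<odot>\<close> 70) where
  "F \<odot> G \<equiv> conv (\<lambda>k. (@)) F G"

definition horizontal_eq :: "nat \<Rightarrow> horizontal series \<Rightarrow> horizontal series \<Rightarrow> bool" where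
  "horizontal_eq N F G \<longleftrightarrow> (let V = \<lambda>H. coeffs_of (map_series (\<lambda>ps. (strand_words N ps, [])) H)
     in eq_4T N 0 (V F) (V G))"

text \<open>The exponential of q times the sum of the chords in S.\<close>

definition exp_chords :: "rat \<Rightarrow> horizontal \<Rightarrow> horizontal series" where
  "exp_chords q S n = [(q ^ n / fact n, ps). ps \<leftarrow> product_lists (replicate n S)]"

text \<open>
  Non-commutative formal power series in A and B over the rationals, and the result of substituting
  for A and B the sums of the chords in S and in S'.
\<close>

datatype letter = A | B

type_synonym nc_series = "letter list \<Rightarrow> rat"

definition substitute :: "nc_series \<Rightarrow> horizontal \<Rightarrow> horizontal \<Rightarrow> horizontal series" where
  "substitute \<phi> S S' n = [(\<phi> w, ps). w \<leftarrow> List.n_lists n [A, B],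
     ps \<leftarrow> product_lists (map (case_letter S S') w)]"

text \<open>The inverse of a series with constant term 1.\<close>

fun nc_inverse :: "nc_series \<Rightarrow> nc_series" where
  "nc_inverse \<phi> [] = 1"
| "nc_inverse \<phi> (a # w) = - (\<Sum>k\<le>length w. \<phi> (a # take k w) * nc_inverse \<phi> (drop k w))"

fun shuffle_list :: "'a list \<Rightarrow> 'a list \<Rightarrow> 'a list list" where
  "shuffle_list [] v = [v]"
| "shuffle_list u [] = [u]"
| "shuffle_list (a # u) (b # v) =
     map (Cons a) (shuffle_list u (b # v)) @ map (Cons b) (shuffle_list (a # u) v)"

text \<open>
  The coefficient of \<open>u \<otimes> v\<close> in the coproduct of \<open>\<phi>\<close>, for which A and B are primitive, is the sum of
  the coefficients of \<open>\<phi>\<close> at the shuffles of u and v (with multiplicity).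
\<close>

definition group_like :: "nc_series \<Rightarrow> bool" where
  "group_like \<phi> \<longleftrightarrow> \<phi> [] = 1 \<and>
     (\<forall>u v. (\<Sum>w\<leftarrow>shuffle_list u v. \<phi> w) = \<phi> u * \<phi> v)"

text \<open>
  Pentagon and hexagon equations, with \<open>exp(t/2)\<close> as the value of the positive crossing. In usual
  notation, and with products in upward order, they read
  \<open>\<phi>(t12, t23) \<phi>(t12 + t13, t24 + t34) \<phi>(t23, t34) = \<phi>(t13 + t23, t34) \<phi>(t12, t23 + t24)\<close>,
  \<open>exp((t13 + t23)/2) = \<phi>(t12, t23) exp(t23/2) \<phi>(t13, t23)^-1 exp(t13/2) \<phi>(t13, t12)\<close>,
  \<open>exp((t12 + t13)/2) = \<phi>(t12, t23)^-1 exp(t12/2) \<phi>(t12, t13) exp(t13/2) \<phi>(t23, t13)^-1\<close>.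
\<close>

definition drinfeld_associator :: "nc_series \<Rightarrow> bool" where
  "drinfeld_associator \<phi> \<longleftrightarrow> group_like \<phi> \<and>
     horizontal_eq 4
       (substitute \<phi> [(0,1)] [(1,2)] \<odot> substitute \<phi> [(0,1),(0,2)] [(1,3),(2,3)]
          \<odot> substitute \<phi> [(1,2)] [(2,3)])
       (substitute \<phi> [(0,2),(1,2)] [(2,3)] \<odot> substitute \<phi> [(0,1)] [(1,2),(1,3)]) \<and>
     horizontal_eq 3
       (exp_chords (1/2) [(0,2),(1,2)])
       (substitute \<phi> [(0,1)] [(1,2)] \<odot> exp_chords (1/2) [(1,2)]
          \<odot> substitute (nc_inverse \<phi>) [(0,2)] [(1,2)] \<odot> exp_chords (1/2) [(0,2)]
          \<odot> substitute \<phi> [(0,2)] [(0,1)]) \<and>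
     horizontal_eq 3
       (exp_chords (1/2) [(0,1),(0,2)])
       (substitute (nc_inverse \<phi>) [(0,1)] [(1,2)] \<odot> exp_chords (1/2) [(0,1)]
          \<odot> substitute \<phi> [(0,1)] [(0,2)] \<odot> exp_chords (1/2) [(0,2)]
          \<odot> substitute (nc_inverse \<phi>) [(1,2)] [(0,2)])"


section \<open>The value of the unknot\<close>

text \<open>The coefficient \<open>b_n\<close> of \<open>x^n\<close> in \<open>ln(sinh(x/2)/(x/2))/2\<close>.\<close>

definition wheel_coeff :: "nat \<Rightarrow> rat" where
  "wheel_coeff n = fps_nth (fps_const (1/2) *
     fps_compose (fps_ln 1) ((fps_exp (1/2) - fps_exp (-1/2)) / fps_X - 1)) n"

text \<open>
  A trivalent vertex is the cyclically ordered triple of the edges at it. The list \<open>[l1, l2, ...]\<close>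
  stands for the disjoint union of wheels with l1, l2, ... legs; the leg is the first edge of each
  vertex of a wheel.
\<close>

type_synonym vertex = "nat \<times> nat \<times> nat"

fun wheels :: "nat \<Rightarrow> nat list \<Rightarrow> vertex list" where
  "wheels z [] = []"
| "wheels z (l # ls) =
     [(z + j, z + l + (j + l - 1) mod l, z + l + j). j \<leftarrow> [0..<l]] @ wheels (z + 2 * l) ls"

definition even_wheels :: "nat list series" where
  "even_wheels n = (if even n \<and> n > 0 then [(wheel_coeff n, [n])] else [])"

fun wheels_power :: "nat \<Rightarrow> nat list series" where
  "wheels_power 0 = (\<lambda>n. if n = 0 then [(1, [])] else [])"
| "wheels_power (Suc k) = conv (\<lambda>k. (@)) even_wheels (wheels_power k)"

definition exp_wheels :: "nat list series" where
  "exp_wheels n = [(c / fact k, ls). k \<leftarrow> [0..<Suc n], (c, ls) \<leftarrow> wheels_power k n]"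

text \<open>
  The word c lists the edges ending on the circle. The STU relation replaces the trivalent vertex
  (e, f, g), where e ends on the circle, by the difference of the two ways of attaching f and g at
  the place of e.
\<close>

fun stu :: "nat list \<Rightarrow> vertex list \<Rightarrow> (rat \<times> nat list) list" where
  "stu c [] = [(1, c)]"
| "stu c ((e, f, g) # vs) =
     stu (concat (map ((\<lambda>l. [l])(e := [f, g])) c)) vs
     @ map (map_prod uminus id) (stu (concat (map ((\<lambda>l. [l])(e := [g, f])) c)) vs)"

text \<open>
  The average is over all arrangements of the legs along the circle, that is, all repetition-free
  words in the legs. A union of wheels with n legs gives chord diagrams of degree n.
\<close>

definition chi_wheels :: "nat list \<Rightarrow> (rat \<times> nat list) list" where
  "chi_wheels ls = (let vs = wheels 0 ls; legs = map fst vs in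
     [(c / fact (length legs), w).
        a \<leftarrow> [a \<leftarrow> List.n_lists (length legs) legs. distinct a], (c, w) \<leftarrow> stu a vs])"

definition nu :: "nat list series" where
  "nu n = [(c * d, w). (c, ls) \<leftarrow> exp_wheels n, (d, w) \<leftarrow> chi_wheels ls]"

text \<open>
  s represents the square root of \<open>\<nu>\<close> with constant term 1. It is given on an oriented strand, as
  needed for cups and caps; words on a strand are multiplied by concatenation, and closing the strand
  is the isomorphism with \<open>\<A>(1)\<close> that defines the multiplication there.
\<close>

definition sqrt_nu :: "nat list series \<Rightarrow> bool" where
  "sqrt_nu s \<longleftrightarrow>
     (\<forall>n. \<forall>(c, w)\<in>set (s n). mset w = mset [0..<n] + mset [0..<n]) \<and>
     (\<Sum>(c, w)\<leftarrow>s 0. c) = 1 \<and>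
     (let V = \<lambda>F. coeffs_of (map_series (\<lambda>w. ([], [w])) F)
      in eq_4T 0 1 (V (conv (\<lambda>k v w. v @ map (\<lambda>l. l + k) w) s s)) (V nu))"


section \<open>q-tangles and framed links\<close>

text \<open>
  A boundary point carries the direction of the strand through it (\<^const>\<open>True\<close> for upward) and the
  number of the component it belongs to. \<^term>\<open>Empty\<close> occurs only as a complete boundary.
\<close>

type_synonym point = "bool \<times> nat"

definition opp :: "point \<Rightarrow> point" where
  "opp p = (\<not> fst p, snd p)"

datatype bracketing = Empty | Pt point | Br bracketing bracketing

fun nonempty :: "bracketing \<Rightarrow> bool" where
  "nonempty Empty = False"
| "nonempty (Pt p) = True"
| "nonempty (Br u v) = (nonempty u \<and> nonempty v)"

fun points :: "bracketing \<Rightarrow> point list" where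
  "points Empty = []"
| "points (Pt p) = [p]"
| "points (Br u v) = points u @ points v"

abbreviation width :: "bracketing \<Rightarrow> nat" where
  "width u \<equiv> length (points u)"

fun juxt :: "bracketing \<Rightarrow> bracketing \<Rightarrow> bracketing" where
  "juxt Empty v = v"
| "juxt u Empty = u"
| "juxt u v = Br u v"

text \<open>
  Framed q-tangles are presented by words in the elementary ones, with blackboard framing; all
  orientations of the strands are allowed.
  \<^item> \<open>Cross \<epsilon> p q\<close> has bottom p, q and top q, p. For \<open>\<epsilon> = True\<close> the strand going from bottom left to top
    right is the over strand, so that the crossing is positive when both strands are upward.
  \<^item> \<open>Cup p\<close> has top p, \<open>opp p\<close>, and \<open>Cap p\<close> has bottom p, \<open>opp p\<close>.
  \<^item> \<open>Assoc True\<close> goes from (uv)w to u(vw), and \<open>Assoc False\<close> back.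
  \<^item> \<open>Juxt S T\<close> puts T to the right of S, and \<open>Comp S T\<close> puts T on top of S.
\<close>

datatype qtangle =
    Strand point
  | Cross bool point point
  | Cup point
  | Cap point
  | Assoc bool bracketing bracketing bracketing
  | Juxt qtangle qtangle
  | Comp qtangle qtangle

fun bot :: "qtangle \<Rightarrow> bracketing" and top :: "qtangle \<Rightarrow> bracketing" where
  "bot (Strand p) = Pt p"
| "bot (Cross \<epsilon> p q) = Br (Pt p) (Pt q)"
| "bot (Cup p) = Empty"
| "bot (Cap p) = Br (Pt p) (Pt (opp p))"
| "bot (Assoc b u v w) = (if b then Br (Br u v) w else Br u (Br v w))"
| "bot (Juxt S T) = juxt (bot S) (bot T)"
| "bot (Comp S T) = bot S"
| "top (Strand p) = Pt p"
| "top (Cross \<epsilon> p q) = Br (Pt q) (Pt p)"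
| "top (Cup p) = Br (Pt p) (Pt (opp p))"
| "top (Cap p) = Empty"
| "top (Assoc b u v w) = (if b then Br u (Br v w) else Br (Br u v) w)"
| "top (Juxt S T) = juxt (top S) (top T)"
| "top (Comp S T) = top T"

fun wf_qtangle :: "qtangle \<Rightarrow> bool" where
  "wf_qtangle (Assoc b u v w) = (nonempty u \<and> nonempty v \<and> nonempty w)"
| "wf_qtangle (Juxt S T) = (wf_qtangle S \<and> wf_qtangle T)"
| "wf_qtangle (Comp S T) = (wf_qtangle S \<and> wf_qtangle T \<and> top S = bot T)"
| "wf_qtangle _ = True"

text \<open>
  A diagram on the 1-manifold underlying a q-tangle: the arcs, each with its component number, its
  initial point, the word of chord names along it and its final point, and the circles, each with its
  component number and its word. Points inside the tangle occur only while a composition is formed.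
\<close>

datatype place = Bot nat | Top nat | Mid nat

type_synonym arc = "nat \<times> place \<times> nat list \<times> place"
type_synonym tdiagram = "arc list \<times> (nat \<times> nat list) list"

definition map_tdiagram :: "(place \<Rightarrow> place) \<Rightarrow> (nat \<Rightarrow> nat) \<Rightarrow> tdiagram \<Rightarrow> tdiagram" where
  "map_tdiagram g h =
     map_prod (map (\<lambda>(c, a, w, b). (c, g a, map h w, g b))) (map (map_prod id (map h)))"

fun join :: "nat \<Rightarrow> tdiagram \<Rightarrow> tdiagram" where
  "join k (as, cs) =
     (let x = hd [x \<leftarrow> as. case x of (c, a, w, b) \<Rightarrow> b = Mid k];
          y = hd [y \<leftarrow> as. case y of (c, a, w, b) \<Rightarrow> a = Mid k];
          (c, a, v, _) = x; (_, _, w, b) = y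
      in if x = y then (remove1 x as, (c, v) # cs)
         else ((c, a, v @ w, b) # remove1 x (remove1 y as), cs))"

definition comp_tdiagram :: "nat \<Rightarrow> nat \<Rightarrow> tdiagram \<Rightarrow> tdiagram \<Rightarrow> tdiagram" where
  "comp_tdiagram r k d e =
     (let (as, cs) = map_tdiagram (case_place Bot Mid Mid) id d;
          (as', cs') = map_tdiagram (case_place Mid Top Mid) (\<lambda>l. l + k) e
      in fold join [0..<r] (as @ as', cs @ cs'))"

definition juxt_tdiagram :: "nat \<Rightarrow> nat \<Rightarrow> nat \<Rightarrow> tdiagram \<Rightarrow> tdiagram \<Rightarrow> tdiagram" where
  "juxt_tdiagram r r' k d e =
     (let (as, cs) = d;
          (as', cs') = map_tdiagram (case_place (\<lambda>j. Bot (j + r)) (\<lambda>j. Top (j + r')) Mid) (\<lambda>l. l + k) e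
      in (as @ as', cs @ cs'))"

text \<open>An arc from a to b carrying w, or its reversal, and the sign coming from the reversal.\<close>

definition oriented :: "bool \<Rightarrow> nat \<Rightarrow> place \<Rightarrow> nat list \<Rightarrow> place \<Rightarrow> arc" where
  "oriented fwd c a w b = (if fwd then (c, a, w, b) else (c, b, rev w, a))"

definition reversal_sign :: "bool \<Rightarrow> nat list \<Rightarrow> rat" where
  "reversal_sign fwd w = (if fwd then 1 else (-1) ^ length w)"

text \<open>
  The strand at position j at the bottom ends at position \<open>\<pi> j\<close> at the top; \<open>ws ! j\<close> is read upwards.
\<close>

definition on_strands :: "point list \<Rightarrow> (nat \<Rightarrow> nat) \<Rightarrow> nat list list \<Rightarrow> rat \<times> tdiagram" where
  "on_strands ps \<pi> ws =
     (\<Prod>j<length ps. reversal_sign (fst (ps ! j)) (ws ! j),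
      map (\<lambda>j. oriented (fst (ps ! j)) (snd (ps ! j)) (Bot j) (ws ! j) (Top (\<pi> j))) [0..<length ps],
      [])"

definition horizontal_on :: "point list \<Rightarrow> (nat \<Rightarrow> nat) \<Rightarrow> horizontal series \<Rightarrow> tdiagram series" where
  "horizontal_on ps \<pi> F n = [(c * d, t). (c, h) \<leftarrow> F n,
     (d, t) \<leftarrow> [on_strands ps \<pi> (strand_words (length ps) h)]]"

definition on_turn :: "bool \<Rightarrow> nat \<Rightarrow> place \<Rightarrow> place \<Rightarrow> nat list series \<Rightarrow> tdiagram series" where
  "on_turn fwd c a b F n = [(q * reversal_sign fwd w, ([oriented fwd c a w b], [])). (q, w) \<leftarrow> F n]"

text \<open>All chords between two blocks of parallel strands.\<close>

definition chords_between :: "nat \<Rightarrow> nat \<Rightarrow> nat \<Rightarrow> horizontal" where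
  "chords_between x y z = [(j, k). j \<leftarrow> [x..<y], k \<leftarrow> [y..<z]]"

definition horizontal_blocks :: "nc_series \<Rightarrow> nat \<Rightarrow> nat \<Rightarrow> nat \<Rightarrow> horizontal series" where
  "horizontal_blocks \<phi> x y z =
     substitute \<phi> (chords_between 0 x (x + y)) (chords_between x (x + y) (x + y + z))"

fun kontsevich_terms :: "nc_series \<Rightarrow> nat list series \<Rightarrow> qtangle \<Rightarrow> tdiagram series" where
  "kontsevich_terms \<phi> s (Strand p) = horizontal_on [p] id (\<lambda>n. if n = 0 then [(1, [])] else [])"
| "kontsevich_terms \<phi> s (Cross \<epsilon> p q) =
     horizontal_on [p, q] (\<lambda>j. 1 - j) (exp_chords (if \<epsilon> then 1/2 else -1/2) [(0, 1)])"
| "kontsevich_terms \<phi> s (Cup p) = on_turn (\<not> fst p) (snd p) (Top 0) (Top 1) s"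
| "kontsevich_terms \<phi> s (Cap p) = on_turn (fst p) (snd p) (Bot 0) (Bot 1) s"
| "kontsevich_terms \<phi> s (Assoc b u v w) =
     horizontal_on (points u @ points v @ points w) id
       (horizontal_blocks (if b then \<phi> else nc_inverse \<phi>) (width u) (width v) (width w))"
| "kontsevich_terms \<phi> s (Juxt S T) =
     conv (juxt_tdiagram (width (bot S)) (width (top S)))
       (kontsevich_terms \<phi> s S) (kontsevich_terms \<phi> s T)"
| "kontsevich_terms \<phi> s (Comp S T) =
     conv (comp_tdiagram (width (top S))) (kontsevich_terms \<phi> s S) (kontsevich_terms \<phi> s T)"

text \<open>The underlying 1-manifold itself, that is, the diagram without chords.\<close>

fun skeleton :: "qtangle \<Rightarrow> tdiagram" where
  "skeleton (Strand p) = snd (on_strands [p] id [[]])"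
| "skeleton (Cross \<epsilon> p q) = snd (on_strands [p, q] (\<lambda>j. 1 - j) [[], []])"
| "skeleton (Cup p) = ([oriented (\<not> fst p) (snd p) (Top 0) [] (Top 1)], [])"
| "skeleton (Cap p) = ([oriented (fst p) (snd p) (Bot 0) [] (Bot 1)], [])"
| "skeleton (Assoc b u v w) = (let ps = points u @ points v @ points w in
     snd (on_strands ps id (replicate (length ps) [])))"
| "skeleton (Juxt S T) =
     juxt_tdiagram (width (bot S)) (width (top S)) 0 (skeleton S) (skeleton T)"
| "skeleton (Comp S T) = comp_tdiagram (width (top S)) 0 (skeleton S) (skeleton T)"

text \<open>Closed words with exactly one circle for each of the component numbers 1, ..., m.\<close>

definition link_words :: "nat \<Rightarrow> qtangle set" where
  "link_words m = {T. wf_qtangle T \<and> bot T = Empty \<and> top T = Empty \<and>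
     mset (map fst (snd (skeleton T))) = mset [1..<Suc m]}"

definition link_code :: "nat \<Rightarrow> tdiagram \<Rightarrow> code" where
  "link_code m d = ([], map (\<lambda>i. the (map_of (snd d) i)) [1..<Suc m])"

text \<open>
  Forgetting the bracketing, a word gives a sliced tangle diagram: a list of events from bottom to
  top, each with the number of strands to its left.
\<close>

datatype event = ECross bool point point | ECup point | ECap point

fun arity_in :: "event \<Rightarrow> nat" where
  "arity_in (ECross \<epsilon> p q) = 2" | "arity_in (ECup p) = 0" | "arity_in (ECap p) = 2"

fun arity_out :: "event \<Rightarrow> nat" where
  "arity_out (ECross \<epsilon> p q) = 2" | "arity_out (ECup p) = 2" | "arity_out (ECap p) = 0"

fun slices :: "nat \<Rightarrow> qtangle \<Rightarrow> (nat \<times> event) list" where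
  "slices k (Strand p) = []"
| "slices k (Cross \<epsilon> p q) = [(k, ECross \<epsilon> p q)]"
| "slices k (Cup p) = [(k, ECup p)]"
| "slices k (Cap p) = [(k, ECap p)]"
| "slices k (Assoc b u v w) = []"
| "slices k (Juxt S T) = slices k S @ slices (k + width (top S)) T"
| "slices k (Comp S T) = slices k S @ slices k T"

text \<open>
  The moves on sliced blackboard-framed diagrams (far commutation, straightening, the framed version
  of the first Reidemeister move, the second and third Reidemeister moves, and sliding a strand across
  a minimum or a maximum) which generate isotopy of framed tangles. The moves hold for all orientations.
  The third Reidemeister move for the other admissible triples of crossings follows from the case below
  and the second move.
\<close>

inductive framed_move :: "(nat \<times> event) list \<Rightarrow> (nat \<times> event) list \<Rightarrow> bool" where
  in_context: "framed_move l r \<Longrightarrow> framed_move (u @ l @ v) (u @ r @ v)"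
| far: "framed_move [(k, g), (k + arity_out g + j, h)] [(k + arity_in g + j, h), (k, g)]"
| straighten_left: "framed_move [(k, ECup p), (Suc k, ECap (opp p))] []"
| straighten_right: "framed_move [(Suc k, ECup (opp p)), (k, ECap p)] []"
| R1_framed: "framed_move [(Suc k, ECup p), (k, ECross \<epsilon> p p), (Suc k, ECap p)]
                [(k, ECup (opp p)), (Suc k, ECross \<epsilon> p p), (k, ECap (opp p))]"
| R2: "framed_move [(k, ECross \<epsilon> p q), (k, ECross (\<not> \<epsilon>) q p)] []"
| R3: "framed_move [(k, ECross \<epsilon> p q), (Suc k, ECross \<epsilon> p r), (k, ECross \<epsilon> q r)]
         [(Suc k, ECross \<epsilon> q r), (k, ECross \<epsilon> p r), (Suc k, ECross \<epsilon> p q)]"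
| slide_cup: "framed_move [(k, ECup p), (Suc k, ECross \<epsilon> (opp p) q)]
                [(Suc k, ECup p), (k, ECross (\<not> \<epsilon>) q p)]"
| slide_cap: "framed_move [(Suc k, ECross \<epsilon> q (opp p)), (k, ECap p)]
                [(k, ECross (\<not> \<epsilon>) p q), (Suc k, ECap p)]"

definition isotopy :: "nat \<Rightarrow> (qtangle \<times> qtangle) set" where
  "isotopy m = (let r = {(S, T). S \<in> link_words m \<and> T \<in> link_words m \<and>
       (slices 0 S = slices 0 T \<or> framed_move (slices 0 S) (slices 0 T))} in (r \<union> r\<inverse>)\<^sup>*)"

text \<open>Framed oriented m-component links, up to isotopy.\<close>

definition framed_links :: "nat \<Rightarrow> qtangle set set" where
  "framed_links m = link_words m // isotopy m"

text \<open>
  For the blackboard framing, the linking number of the ith component with its parallel is the sum of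
  the signs of its self-crossings.
\<close>

fun self_crossing_sign :: "nat \<Rightarrow> event \<Rightarrow> int" where
  "self_crossing_sign i (ECross \<epsilon> p q) =
     (if snd p = i \<and> snd q = i then (if \<epsilon> = (fst p = fst q) then 1 else -1) else 0)"
| "self_crossing_sign i _ = 0"

definition writhe :: "nat \<Rightarrow> qtangle \<Rightarrow> int" where
  "writhe i T = (\<Sum>(k, g)\<leftarrow>slices 0 T. self_crossing_sign i g)"

definition framing :: "nat \<Rightarrow> qtangle set \<Rightarrow> int" where
  "framing i L = (THE z. \<forall>T\<in>L. writhe i T = z)"

text \<open>
  The framed Kontsevich integral of a link, as an element of \<open>\<A>(m)\<close>: by its invariance, all words
  representing L give the same coset.
\<close>

definition kontsevich_word ::
    "nc_series \<Rightarrow> nat list series \<Rightarrow> nat \<Rightarrow> qtangle \<Rightarrow> chord_diagram \<Rightarrow> rat" where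
  "kontsevich_word \<phi> s m T = coeffs_of (map_series (link_code m) (kontsevich_terms \<phi> s T))"

definition kontsevich ::
    "nc_series \<Rightarrow> nat list series \<Rightarrow> nat \<Rightarrow> qtangle set \<Rightarrow> (chord_diagram \<Rightarrow> rat) set" where
  "kontsevich \<phi> s m L = (\<Union>T\<in>L. coset_4T 0 m (kontsevich_word \<phi> s m T))"

end

theory Submission
  imports Defs
begin

text \<open>
  Sending a chord diagram to 1 if all its chords lie on the ith circle and to 0 otherwise is a
  functional that only depends on which letters occur on which component; it is therefore unchanged
  when adjacent endpoints are swapped and vanishes on the 4T relators. On tangles it is
  multiplicative under composition and juxtaposition, so it is determined by its generating
  functions on the elementary ones. A self-crossing of sign \<open>\<epsilon>\<close> contributes \<open>exp(\<epsilon> x / 2)\<close>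
  and any other crossing 1. STU makes all wheels cancel, so \<open>\<nu>\<close> and its square root contribute 1.
  An associator contributes the abelianization of the group-like series \<open>\<phi>\<close>, which is
  1 because the pentagon forces the degree 1 part of \<open>\<phi>\<close> to vanish. The product is
  \<open>exp(w x / 2)\<close>, where w is the writhe of the ith component.
\<close>


text \<open>Both intervals (for the associator equations) and circles (for links) are needed, so the
  functional is set up for an arbitrary set \<open>J\<close> of components of any 1-manifold.
  Testing the pentagon in degree 1 on the strand pairs {0, 1} and {2, 3} reads off 2a = a for the
  two linear coefficients a of \<open>\<phi>\<close>.

  Signs of crossings with downward strands come out right because every chord at a crossing has one
  endpoint on each of its two strands, and each endpoint on a downward strand costs a factor -1.

  The obstacle is gluing. Multiplicativity under composition holds only if every glued point is the
  start of exactly one arc and the end of exactly one arc, with matching component numbers; and a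
  closed diagram becomes a legal code only if its circles carry the numbers 1, ..., m once each and
  every chord name occurs twice. Hence three invariants are carried along for every term of the
  integral: its boundary, its underlying 1-manifold, and its multiset of chord names. The value is
  computed on one word representing the link; it depends on the link alone because every framed move
  preserves the signed count of self-crossings.\<close>

definition total :: "('a \<Rightarrow> rat) \<Rightarrow> 'a series \<Rightarrow> nat \<Rightarrow> rat" where
  "total g F n = (\<Sum>(c, x)\<leftarrow>F n. c * g x)"

lemma sum_list_concat_map:
  "(\<Sum>x\<leftarrow>concat xss. f x) = (\<Sum>xs\<leftarrow>xss. \<Sum>x\<leftarrow>xs. f x)" for f :: "'a \<Rightarrow> 'b::comm_monoid_add"
  by (induction xss) auto

lemma sum_list_swap:
  "(\<Sum>a\<in>S. \<Sum>x\<leftarrow>xs. f a x) = (\<Sum>x\<leftarrow>xs. \<Sum>a\<in>S. f a x)" for f :: "'a \<Rightarrow> 'b \<Rightarrow> 'c::comm_monoid_add"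
  by (induction xs) (auto simp: sum.distrib)

lemma total_cong:
  assumes "\<And>c x. (c, x) \<in> set (F n) \<Longrightarrow> g x = h x"
  shows "total g F n = total h F n"
  unfolding total_def by (rule arg_cong[where f = sum_list]) (use assms in auto)

lemma total_map_series: "total g (map_series h F) n = total (g \<circ> h) F n"
  unfolding total_def map_series_def by (simp add: comp_def split_def)

text \<open>A multiplicative function turns the graded product into the Cauchy product of generating
  functions. Multiplicativity is demanded only for terms that occur, since for diagrams it relies on
  matching boundaries; and \<open>g\<close>, \<open>g1\<close>, \<open>g2\<close> may differ, since
  an indicator of degree \<open>n\<close> splits into functions of lower degrees.\<close>

lemma total_conv:
  assumes "\<And>k c x d y. \<lbrakk>k \<le> n; (c, x) \<in> set (F k); (d, y) \<in> set (G (n - k))\<rbrakk>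
    \<Longrightarrow> g (mul k x y) = g1 x * g2 y"
  shows "total g (conv mul F G) n = (\<Sum>k\<le>n. total g1 F k * total g2 G (n - k))"
proof -
  have inner: "(\<Sum>(c, x)\<leftarrow>F k. \<Sum>(d, y)\<leftarrow>G (n - k). c * d * g (mul k x y))
      = total g1 F k * total g2 G (n - k)" if "k \<le> n" for k
  proof -
    have "(\<Sum>(c, x)\<leftarrow>F k. \<Sum>(d, y)\<leftarrow>G (n - k). c * d * g (mul k x y))
      = (\<Sum>(c, x)\<leftarrow>F k. \<Sum>(d, y)\<leftarrow>G (n - k). (c * g1 x) * (d * g2 y))"
      by (rule arg_cong[where f = sum_list])
        (use assms[OF that] in \<open>auto intro!: arg_cong[where f = sum_list]\<close>)
    also have "\<dots> = total g1 F k * total g2 G (n - k)"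
      unfolding total_def
      by (simp add: sum_list_mult_const[symmetric] sum_list_const_mult split_def)
    finally show ?thesis .
  qed
  have "total g (conv mul F G) n
      = (\<Sum>k\<leftarrow>[0..<Suc n]. \<Sum>(c, x)\<leftarrow>F k. \<Sum>(d, y)\<leftarrow>G (n - k). c * d * g (mul k x y))"
    unfolding total_def conv_def
    by (simp only: sum_list_concat_map map_map comp_def split_def fst_conv snd_conv)
  also have "\<dots> = (\<Sum>k\<leftarrow>[0..<Suc n]. total g1 F k * total g2 G (n - k))"
    by (rule arg_cong[where f = sum_list]) (simp add: inner del: upt_Suc)
  finally show ?thesis
    by (simp add: interv_sum_list_conv_sum_set_nat atLeast0AtMost[symmetric]
        atLeastLessThanSuc_atLeastAtMost del: upt_Suc)
qed

lemma conv_elem: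
  assumes "(e, z) \<in> set (conv mul F G n)"
  obtains k c x d y where "k \<le> n" "(c, x) \<in> set (F k)" "(d, y) \<in> set (G (n - k))"
    "z = mul k x y"
  using assms unfolding conv_def by (auto simp: less_Suc_eq_le simp del: upt_Suc)

section \<open>Well-definedness of the functional\<close>

text \<open>Components are indexed from 0, intervals before circles. Associators are tested on four
  intervals with two-element \<open>J\<close>, links on circles with \<open>J\<close> the singleton
  of \<open>i - 1\<close>.\<close>

definition supported_codes :: "nat \<Rightarrow> nat \<Rightarrow> nat set \<Rightarrow> nat \<Rightarrow> code set" where
  "supported_codes p q J n = {x \<in> codes p q. length (endpoints x) = 2 * n \<and>
     (\<forall>j<p + q. j \<notin> J \<longrightarrow> (fst x @ snd x) ! j = [])}"

definition support_functional ::
    "nat \<Rightarrow> nat \<Rightarrow> nat set \<Rightarrow> nat \<Rightarrow> (chord_diagram \<Rightarrow> rat) \<Rightarrow> rat" where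
  "support_functional p q J n f = (\<Sum>D\<in>diagram ` supported_codes p q J n. f D)"

text \<open>Membership in \<open>supported_codes\<close> expressed by the multisets of names on the
  components alone, so that reordering endpoints along a component visibly changes nothing.\<close>

definition supported_letters ::
    "nat \<Rightarrow> nat \<Rightarrow> nat set \<Rightarrow> nat \<Rightarrow> nat multiset list \<Rightarrow> nat multiset list \<Rightarrow> bool" where
  "supported_letters p q J n us vs \<longleftrightarrow> length us = p \<and> length vs = q \<and>
     (\<forall>l. count (sum_list (us @ vs)) l \<in> {0, 2}) \<and> size (sum_list (us @ vs)) = 2 * n \<and>
     (\<forall>j<p + q. j \<notin> J \<longrightarrow> (us @ vs) ! j = {#})"

lemma supported_codes_iff:
  "x \<in> supported_codes p q J n \<longleftrightarrow>
     supported_letters p q J n (map mset (fst x)) (map mset (snd x))"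
proof -
  have e: "mset (endpoints x) = sum_list (map mset (fst x) @ map mset (snd x))"
    unfolding endpoints_def by (simp add: mset_concat)
  have "count_list (endpoints x) l = count (sum_list (map mset (fst x) @ map mset (snd x))) l" for l
    by (metis e count_mset)
  moreover have "length (endpoints x) = size (sum_list (map mset (fst x) @ map mset (snd x)))"
    by (metis e size_mset)
  moreover have "(fst x @ snd x) ! j = [] \<longleftrightarrow> (map mset (fst x) @ map mset (snd x)) ! j = {#}"
    if "j < length (fst x) + length (snd x)" for j
    using nth_map[of j "fst x @ snd x" mset] that by simp
  ultimately show ?thesis
    unfolding supported_codes_def codes_def supported_letters_def
    by (auto simp del: mset_zero_iff sum_list_append)
qed

lemma supported_codes_cong:
  assumes "map mset (fst x) = map mset (fst y)" "map mset (snd x) = map mset (snd y)"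
  shows "x \<in> supported_codes p q J n \<longleftrightarrow> y \<in> supported_codes p q J n"
  unfolding supported_codes_iff assms ..

lemma mset_rotate: "mset (rotate r w) = mset w"
  by (metis append_take_drop_id mset_append rotate_drop_take union_commute)

lemma count_image_mset_inj_on:
  assumes "inj_on f (set_mset M)" "k \<in># M"
  shows "count (image_mset f M) (f k) = count M k"
proof -
  have "f -` {f k} \<inter> set_mset M = {k}"
    using assms by (auto simp: inj_on_def)
  then show ?thesis by (simp add: count_image_mset)
qed

lemma same_diagram_refl: "same_diagram x x"
  unfolding same_diagram_def
  by (intro exI[of _ id]) (auto intro!: list_all2_refl exI[of _ 0] simp: list.rel_refl)

lemma rename_same_diagram:
  assumes "same_diagram x y"
  obtains f where "inj_on f (set (endpoints x))"
    "map mset (fst y) = map (image_mset f \<circ> mset) (fst x)"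
    "map mset (snd y) = map (image_mset f \<circ> mset) (snd x)"
proof -
  obtain f where f: "inj_on f (set (endpoints x))" "fst y = map (map f) (fst x)"
    "list_all2 (\<lambda>v w. \<exists>r. w = rotate r (map f v)) (snd x) (snd y)"
    using assms unfolding same_diagram_def by blast
  have "map mset (snd y) = map (image_mset f \<circ> mset) (snd x)"
    using f(3) by (induction rule: list_all2_induct) (auto simp: mset_rotate)
  with f(1,2) show ?thesis by (intro that[of f]) auto
qed

text \<open>Multisets forget the base points, and an injective renaming keeps all multiplicities. So
  \<open>supported_codes\<close> is closed under passing to another code of the same
  diagram.\<close>

lemma same_diagram_supported:
  assumes "same_diagram x y" "x \<in> supported_codes p q J n"
  shows "y \<in> supported_codes p q J n"
proof -
  obtain f where f: "inj_on f (set (endpoints x))"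
    "map mset (fst y) = map (image_mset f \<circ> mset) (fst x)"
    "map mset (snd y) = map (image_mset f \<circ> mset) (snd x)"
    using rename_same_diagram[OF assms(1)] .
  define us where "us = map mset (fst x)"
  define vs where "vs = map mset (snd x)"
  have y: "map mset (fst y) = map (image_mset f) us" "map mset (snd y) = map (image_mset f) vs"
    using f unfolding us_def vs_def by auto
  have x: "supported_letters p q J n us vs"
    using assms(2) unfolding supported_codes_iff us_def vs_def .
  have inj: "inj_on f (set_mset (sum_list (us @ vs)))"
  proof -
    have "mset (endpoints x) = sum_list (us @ vs)"
      unfolding endpoints_def us_def vs_def by (simp add: mset_concat)
    then show ?thesis using f(1) by (metis set_mset_mset)
  qed
  have "sum_list (map (image_mset f) ws) = image_mset f (sum_list ws)" for ws
    by (induction ws) auto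
  then have e: "sum_list (map (image_mset f) us @ map (image_mset f) vs)
      = image_mset f (sum_list (us @ vs))"
    by (metis map_append)
  have "count (image_mset f (sum_list (us @ vs))) l \<in> {0, 2}" for l
  proof (cases "l \<in> f ` set_mset (sum_list (us @ vs))")
    case True
    then obtain k where "k \<in># sum_list (us @ vs)" "l = f k" by blast
    then have "count (image_mset f (sum_list (us @ vs))) l = count (sum_list (us @ vs)) k"
      using count_image_mset_inj_on[OF inj] by simp
    then show ?thesis using x unfolding supported_letters_def by simp
  next
    case False
    then show ?thesis by (metis count_eq_zero_iff insertI1 set_image_mset)
  qed
  moreover have "(map (image_mset f) us @ map (image_mset f) vs) ! j = image_mset f ((us @ vs) ! j)"
    if "j < p + q" for j
    using that x nth_map[of j "us @ vs"] unfolding supported_letters_def by simp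
  ultimately show ?thesis
    using x unfolding supported_codes_iff y supported_letters_def e by simp
qed

lemma diagram_in_supported:
  "diagram x \<in> diagram ` supported_codes p q J n \<longleftrightarrow> x \<in> supported_codes p q J n"
proof
  assume "diagram x \<in> diagram ` supported_codes p q J n"
  then obtain y where y: "diagram x = diagram y" "y \<in> supported_codes p q J n" by auto
  have "x \<in> diagram x" using same_diagram_refl[of x] unfolding diagram_def by simp
  then have "x \<in> diagram y" unfolding y(1) .
  then show "x \<in> supported_codes p q J n"
    using same_diagram_supported[OF _ y(2)] unfolding diagram_def by simp
qed auto

lemma same_diagram_length:
  assumes "same_diagram x y"
  shows "length (endpoints y) = length (endpoints x)"
proof -
  obtain f where "map mset (fst y) = map (image_mset f \<circ> mset) (fst x)"
    "map mset (snd y) = map (image_mset f \<circ> mset) (snd x)"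
    using rename_same_diagram[OF assms] by metis
  then have "map size (map mset (fst y)) = map length (fst x)"
    "map size (map mset (snd y)) = map length (snd x)"
    by (simp_all only: map_map) (simp_all add: comp_def)
  then have "map length (fst y) = map length (fst x)" "map length (snd y) = map length (snd x)"
    by (simp_all add: comp_def)
  then show ?thesis unfolding endpoints_def by (simp add: length_concat)
qed

text \<open>\<open>deg\<close> inspects an arbitrarily chosen code; the choice is harmless because
  all codes of a diagram have equally many endpoints.\<close>

lemma deg_diagram: "deg (diagram x) = length (endpoints x) div 2"
proof -
  have "same_diagram x (SOME y. y \<in> diagram x)"
    using same_diagram_refl[of x] unfolding diagram_def by (metis mem_Collect_eq someI)
  then show ?thesis
    unfolding deg_def by (simp add: same_diagram_length)
qed

text \<open>Serves finiteness: names are arbitrary natural numbers, and this allows them to be moved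
  into a bounded range.\<close>

lemma diagram_rename:
  assumes "inj_on f (set (endpoints x))"
  shows "diagram (map_prod (map (map f)) (map (map f)) x) = diagram x"
proof -
  define z where "z = map_prod (map (map f)) (map (map f)) x"
  have z: "fst z = map (map f) (fst x)" "snd z = map (map f) (snd x)"
    unfolding z_def by simp_all
  have s: "set (endpoints z) = f ` set (endpoints x)"
    unfolding endpoints_def z by auto
  have "same_diagram x y" if zy: "same_diagram z y" for y
  proof -
    obtain g where g: "inj_on g (f ` set (endpoints x))" "fst y = map (map g) (fst z)"
      "list_all2 (\<lambda>v w. \<exists>r. w = rotate r (map g v)) (snd z) (snd y)"
      using zy unfolding same_diagram_def s by blast
    have "inj_on (g \<circ> f) (set (endpoints x))"
      using assms g(1) by (rule comp_inj_on)
    moreover have "fst y = map (map (g \<circ> f)) (fst x)"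
      unfolding g(2) z by simp
    moreover have "list_all2 (\<lambda>v w. \<exists>r. w = rotate r (map (g \<circ> f) v)) (snd x) (snd y)"
      using g(3) unfolding z list_all2_map1 map_map .
    ultimately show ?thesis unfolding same_diagram_def by blast
  qed
  moreover have "same_diagram z y" if xy: "same_diagram x y" for y
  proof -
    obtain g where g: "inj_on g (set (endpoints x))" "fst y = map (map g) (fst x)"
      "list_all2 (\<lambda>v w. \<exists>r. w = rotate r (map g v)) (snd x) (snd y)"
      using xy unfolding same_diagram_def by blast
    \<comment> \<open>Undo \<open>f\<close> on the names that occur, then apply \<open>g\<close>;
      injectivity of \<open>f\<close> gives \<open>h (f l) = g l\<close> there.\<close>
    define h where "h = g \<circ> inv_into (set (endpoints x)) f"
    have hf: "h (f l) = g l" if "l \<in> set (endpoints x)" for l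
      unfolding h_def using that assms by simp
    have m: "map h (map f w) = map g w" if "w \<in> set (fst x) \<union> set (snd x)" for w
    proof -
      have "set w \<subseteq> set (endpoints x)" using that unfolding endpoints_def by auto
      then show ?thesis using hf by auto
    qed
    have "inj_on h (f ` set (endpoints x))"
      using g(1) hf unfolding inj_on_def by auto
    moreover have "fst y = map (map h) (fst z)"
      unfolding g(2) z map_map[of "map h"] by (rule map_cong) (use m in \<open>simp_all only: comp_apply Un_iff simp_thms\<close>)
    moreover have "list_all2 (\<lambda>v w. \<exists>r. w = rotate r (map h v)) (snd z) (snd y)"
      unfolding z list_all2_map1 using g(3)
      by (rule list.rel_mono_strong) (use m in \<open>simp only: Un_iff simp_thms\<close>)
    ultimately show ?thesis unfolding same_diagram_def s by blast
  qed
  ultimately show ?thesis unfolding diagram_def z_def by blast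
qed

text \<open>At most \<open>2 * n\<close> names occur, so every such diagram has a code with names
  below \<open>2 * n\<close>, made of words of length at most \<open>2 * n\<close>; there are
  finitely many of these. Finiteness makes the sum in \<open>support_functional\<close> a genuine
  sum.\<close>

lemma finite_supported_diagrams: "finite (diagram ` supported_codes p q J n)"
proof -
  define W where "W = {w :: nat list. set w \<subseteq> {..<2 * n} \<and> length w \<le> 2 * n}"
  have "finite W" unfolding W_def by (rule finite_lists_length_le) simp
  define X where "X = {vs. set vs \<subseteq> W \<and> length vs = p} \<times> {vs. set vs \<subseteq> W \<and> length vs = q}"
  have "finite X" unfolding X_def
    using \<open>finite W\<close> by (intro finite_cartesian_product finite_lists_length_eq)
  have "diagram x \<in> diagram ` X" if x: "x \<in> supported_codes p q J n" for x
  proof -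
    have len: "length (endpoints x) = 2 * n"
      using x unfolding supported_codes_def by blast
    then have "card (set (endpoints x)) \<le> card {..<2 * n}"
      by (metis card_length card_lessThan)
    then obtain f where f: "f ` set (endpoints x) \<subseteq> {..<2 * n}" "inj_on f (set (endpoints x))"
      using card_le_inj[OF finite_set finite_lessThan] by blast
    have w: "map f w \<in> W" if "w \<in> set (fst x @ snd x)" for w
    proof -
      have "set w \<subseteq> set (endpoints x)"
        using that unfolding endpoints_def by auto
      moreover have "length w \<le> length (endpoints x)"
        using that member_le_sum_list[of "length w" "map length (fst x @ snd x)"]
        unfolding endpoints_def by (auto simp: length_concat)
      ultimately show ?thesis using f(1) len unfolding W_def by auto
    qed
    have "length (fst x) = p" "length (snd x) = q"
      using x unfolding supported_codes_def codes_def by blast+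
    then have "map_prod (map (map f)) (map (map f)) x \<in> X"
      using w unfolding X_def mem_Times_iff by (simp add: image_subset_iff)
    then show ?thesis by (metis diagram_rename[OF f(2)] imageI)
  qed
  then have "diagram ` supported_codes p q J n \<subseteq> diagram ` X" by blast
  then show ?thesis using \<open>finite X\<close> finite_subset by blast
qed

lemma support_functional_single:
  "support_functional p q J n (single (diagram x)) = of_bool (x \<in> supported_codes p q J n)"
proof -
  have "support_functional p q J n (single (diagram x))
      = of_bool (diagram x \<in> diagram ` supported_codes p q J n)"
    unfolding support_functional_def single_def of_bool_def
    by (rule sum.delta[OF finite_supported_diagrams])
  then show ?thesis unfolding diagram_in_supported .
qed

lemma mset_plug:
  assumes "\<And>l. mset (\<sigma> l) = mset (\<tau> l)"
  shows "map mset (fst (plug \<sigma> x)) = map mset (fst (plug \<tau> x))"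
    "map mset (snd (plug \<sigma> x)) = map mset (snd (plug \<tau> x))"
proof -
  have "mset (concat (map \<sigma> w)) = mset (concat (map \<tau> w))" for w
    using assms by (induction w) auto
  then have "map (mset \<circ> (\<lambda>w. concat (map \<sigma> w))) ws = map (mset \<circ> (\<lambda>w. concat (map \<tau> w))) ws" for ws
    by (simp only: comp_def)
  then show "map mset (fst (plug \<sigma> x)) = map mset (fst (plug \<tau> x))"
    "map mset (snd (plug \<sigma> x)) = map mset (snd (plug \<tau> x))"
    by (simp_all only: plug_def Let_def fst_map_prod snd_map_prod map_map)
qed

text \<open>The two substitutions put the same names on each component, only in a different
  order.\<close>

lemma support_functional_plug:
  assumes "\<And>l. mset (\<sigma> l) = mset (\<tau> l)"
  shows "support_functional p q J n (single (diagram (plug \<sigma> x)))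
    = support_functional p q J n (single (diagram (plug \<tau> x)))"
  unfolding support_functional_single supported_codes_cong[OF mset_plug[OF assms]] ..

lemma support_functional_add:
  "support_functional p q J n (f + g) = support_functional p q J n f + support_functional p q J n g"
  unfolding support_functional_def by (simp add: sum.distrib)

lemma support_functional_diff:
  "support_functional p q J n (f - g) = support_functional p q J n f - support_functional p q J n g"
  unfolding support_functional_def by (simp add: sum_subtractf)

lemma support_functional_relator:
  assumes "h \<in> four_T_relators p q k"
  shows "support_functional p q J n h = 0"
proof -
  obtain a b P Q R x where h: "h =
      single (diagram (plug ((\<lambda>l. [l])(P := [a, b], Q := [a], R := [b])) x))
    - single (diagram (plug ((\<lambda>l. [l])(P := [b, a], Q := [a], R := [b])) x))
    + single (diagram (plug ((\<lambda>l. [l])(P := [a], Q := [a, b], R := [b])) x))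
    - single (diagram (plug ((\<lambda>l. [l])(P := [a], Q := [b, a], R := [b])) x))"
    using assms unfolding four_T_relators_def by blast
  \<comment> \<open>The four terms cancel in two pairs: within a pair the endpoints \<open>a\<close>
    and \<open>b\<close> are swapped at the single place \<open>P\<close>, respectively
    \<open>Q\<close>.\<close>
  have "support_functional p q J n
        (single (diagram (plug ((\<lambda>l. [l])(P := [a, b], Q := [a], R := [b])) x)))
      = support_functional p q J n
        (single (diagram (plug ((\<lambda>l. [l])(P := [b, a], Q := [a], R := [b])) x)))"
    "support_functional p q J n
        (single (diagram (plug ((\<lambda>l. [l])(P := [a], Q := [a, b], R := [b])) x)))
      = support_functional p q J n
        (single (diagram (plug ((\<lambda>l. [l])(P := [a], Q := [b, a], R := [b])) x)))"
    by (rule support_functional_plug, simp)+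
  then show ?thesis unfolding h support_functional_add support_functional_diff by linarith
qed

text \<open>The 4T equivalence is imposed degree by degree and the functional sees degree
  \<open>n\<close> only, so it suffices that its kernel is a subspace containing the relators of
  that degree.\<close>

lemma support_functional_eq_4T:
  assumes "eq_4T p q f g"
  shows "support_functional p q J n f = support_functional p q J n g"
proof -
  interpret M: module "\<lambda>(c::rat) h (D::chord_diagram). c * h D"
    by standard (auto simp: fun_eq_iff algebra_simps)
  define h where "h = (\<lambda>D. if deg D = n then f D - g D else 0)"
  have "h \<in> M.span (four_T_relators p q n)"
    using assms unfolding eq_4T_def h_def by simp
  then have "support_functional p q J n h = 0"
  proof (induction rule: M.span_induct)
    case base
    show ?case unfolding M.subspace_def
      by (auto simp: support_functional_add)
        (auto simp: support_functional_def simp flip: sum_distrib_left)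
  next
    case (step x)
    then show ?case by (rule support_functional_relator)
  qed
  moreover have "support_functional p q J n h = support_functional p q J n (f - g)"
    unfolding support_functional_def h_def
    by (rule sum.cong) (auto simp: deg_diagram supported_codes_def)
  ultimately show ?thesis by (simp add: support_functional_diff)
qed

text \<open>Exchanging the two sums, each term of the list contributes to exactly one
  diagram.\<close>

lemma support_functional_coeffs_of:
  "support_functional p q J n (coeffs_of F)
    = total (\<lambda>x. of_bool (x \<in> supported_codes p q J n)) F n"
proof -
  let ?S = "diagram ` supported_codes p q J n"
  have "support_functional p q J n (coeffs_of F)
      = (\<Sum>D\<in>?S. \<Sum>(c, x)\<leftarrow>F n. if diagram x = D then c else 0)"
    unfolding support_functional_def coeffs_of_def
    by (rule sum.cong) (auto simp: deg_diagram supported_codes_def)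
  also have "\<dots> = (\<Sum>(c, x)\<leftarrow>F n. \<Sum>D\<in>?S. if diagram x = D then c else 0)"
    unfolding split_def by (rule sum_list_swap)
  also have "\<dots> = (\<Sum>(c, x)\<leftarrow>F n. c * of_bool (x \<in> supported_codes p q J n))"
    unfolding sum.delta'[OF finite_supported_diagrams] diagram_in_supported
    by (intro arg_cong[where f = sum_list] map_cong) auto
  finally show ?thesis unfolding total_def .
qed

lemma eq_4T_total:
  assumes "eq_4T p q (coeffs_of F) (coeffs_of G)"
  shows "total (\<lambda>x. of_bool (x \<in> supported_codes p q J n)) F n
    = total (\<lambda>x. of_bool (x \<in> supported_codes p q J n)) G n"
  using support_functional_eq_4T[OF assms] unfolding support_functional_coeffs_of .


section \<open>The value of an associator\<close>

lemma sum_product_lists: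
  "(\<Sum>ps\<leftarrow>product_lists xss. prod_list (map g ps)) = prod_list (map (\<lambda>xs. \<Sum>x\<leftarrow>xs. g x) xss)"
  for g :: "'a \<Rightarrow> rat"
proof (induction xss)
  case (Cons xs xss)
  show ?case
    by (simp add: sum_list_concat_map comp_def sum_list_const_mult Cons.IH flip: sum_list_mult_const)
qed simp

section \<open>Abelianization of group-like series\<close>

definition word_sum :: "nat \<Rightarrow> (letter list \<Rightarrow> rat) \<Rightarrow> rat" where
  "word_sum n f = (\<Sum>w\<leftarrow>List.n_lists n [A, B]. f w)"

lemma word_sum_0: "word_sum 0 f = f []"
  unfolding word_sum_def by simp

lemma word_sum_Suc: "word_sum (Suc n) f = word_sum n (\<lambda>w. f (A # w) + f (B # w))"
  unfolding word_sum_def by (simp add: sum_list_concat_map comp_def)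

lemma word_sum_add: "word_sum n (\<lambda>w. f w + g w) = word_sum n f + word_sum n g"
  unfolding word_sum_def by (simp add: sum_list_addf)

lemma word_sum_cong:
  assumes "\<And>w. length w = n \<Longrightarrow> f w = g w"
  shows "word_sum n f = word_sum n g"
  unfolding word_sum_def
  by (intro arg_cong[where f = sum_list] map_cong) (use assms in \<open>auto simp: set_n_lists\<close>)

lemma word_sum_sum: "word_sum n (\<lambda>w. \<Sum>k\<in>K. f k w) = (\<Sum>k\<in>K. word_sum n (f k))"
  unfolding word_sum_def by (rule sum_list_swap[symmetric])

lemma word_sum_const_mult: "word_sum n (\<lambda>w. c * f w) = c * word_sum n f"
  unfolding word_sum_def by (rule sum_list_const_mult)

text \<open>A word of length \<open>j + r\<close> is uniquely a prefix of length \<open>j\<close>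
  followed by a suffix of length \<open>r\<close>.\<close>

lemma word_sum_split:
  "word_sum (j + r) (\<lambda>w. f (take j w) * g (drop j w)) = word_sum j f * word_sum r g"
proof (induction j arbitrary: f)
  case 0
  then show ?case by (simp add: word_sum_0 word_sum_const_mult)
next
  case (Suc j)
  show ?case
    using Suc.IH[of "\<lambda>w. f (A # w) + f (B # w)"] by (simp add: word_sum_Suc distrib_right)
qed

text \<open>Double counting: a word of length \<open>n + 1\<close> arises in exactly
  \<open>n + 1\<close> ways, one per position, by inserting a letter into a word of length
  \<open>n\<close>. Combined with the shuffle relations this ties degree \<open>n + 1\<close> of the
  abelianization to degrees 1 and \<open>n\<close>.\<close>

lemma word_sum_insert:
  "word_sum n (\<lambda>v. \<Sum>w\<leftarrow>shuffle_list [A] v. f w) + word_sum n (\<lambda>v. \<Sum>w\<leftarrow>shuffle_list [B] v. f w)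
    = of_nat (Suc n) * word_sum (Suc n) f"
proof (induction n arbitrary: f)
  case 0
  then show ?case by (simp add: word_sum_0 word_sum_Suc)
next
  case (Suc n)
  have eq: "(\<Sum>w\<leftarrow>shuffle_list [a] (b # v). f w) = f (a # b # v) + (\<Sum>w\<leftarrow>shuffle_list [a] v. f (b # w))"
    for a b v
    by (simp add: comp_def)
  have "word_sum (Suc n) (\<lambda>v. \<Sum>w\<leftarrow>shuffle_list [A] v. f w)
      + word_sum (Suc n) (\<lambda>v. \<Sum>w\<leftarrow>shuffle_list [B] v. f w)
      = word_sum (Suc (Suc n)) f
        + (word_sum n (\<lambda>v. \<Sum>w\<leftarrow>shuffle_list [A] v. f (A # w))
          + word_sum n (\<lambda>v. \<Sum>w\<leftarrow>shuffle_list [B] v. f (A # w)))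
        + (word_sum n (\<lambda>v. \<Sum>w\<leftarrow>shuffle_list [A] v. f (B # w))
          + word_sum n (\<lambda>v. \<Sum>w\<leftarrow>shuffle_list [B] v. f (B # w)))"
    by (simp only: word_sum_Suc eq word_sum_add)
  also have "\<dots> = of_nat (Suc (Suc n)) * word_sum (Suc (Suc n)) f"
    unfolding Suc.IH by (simp add: word_sum_Suc word_sum_add algebra_simps)
  finally show ?case .
qed

definition abelianize :: "rat \<Rightarrow> rat \<Rightarrow> letter list \<Rightarrow> rat" where
  "abelianize \<alpha> \<beta> w = prod_list (map (case_letter \<alpha> \<beta>) w)"

lemma abelianize_shuffle:
  "w \<in> set (shuffle_list u v) \<Longrightarrow> abelianize \<alpha> \<beta> w = abelianize \<alpha> \<beta> u * abelianize \<alpha> \<beta> v"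
  by (induction u v arbitrary: w rule: shuffle_list.induct) (auto simp: abelianize_def)

text \<open>In general a group-like series abelianizes to the exponential of its linear part, here
  zero. Shuffles of \<open>[a]\<close> with \<open>v\<close> all have the same abelian value, and
  their coefficients add up to \<open>\<phi> [a] * \<phi> v = 0\<close>;
  \<open>word_sum_insert\<close> then makes a positive multiple of the coefficient vanish.\<close>

lemma group_like_abelianize:
  assumes "group_like \<phi>" "\<phi> [A] = 0" "\<phi> [B] = 0"
  shows "word_sum n (\<lambda>w. \<phi> w * abelianize \<alpha> \<beta> w) = of_bool (n = 0)"
proof (cases n)
  case 0
  then show ?thesis using assms(1) by (simp add: word_sum_0 group_like_def abelianize_def)
next
  case (Suc k)
  have "(\<Sum>w\<leftarrow>shuffle_list [a] v. \<phi> w * abelianize \<alpha> \<beta> w) = 0" for a v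
  proof -
    have "(\<Sum>w\<leftarrow>shuffle_list [a] v. \<phi> w * abelianize \<alpha> \<beta> w)
        = (\<Sum>w\<leftarrow>shuffle_list [a] v. \<phi> w * (abelianize \<alpha> \<beta> [a] * abelianize \<alpha> \<beta> v))"
      by (intro arg_cong[where f = sum_list] map_cong refl) (metis abelianize_shuffle)
    also have "\<dots> = \<phi> [a] * \<phi> v * (abelianize \<alpha> \<beta> [a] * abelianize \<alpha> \<beta> v)"
      using assms(1) unfolding group_like_def by (simp only: sum_list_mult_const)
    also have "\<phi> [a] = 0" using assms(2,3) by (cases a) auto
    finally show ?thesis by simp
  qed
  then show ?thesis
    using word_sum_insert[of k "\<lambda>w. \<phi> w * abelianize \<alpha> \<beta> w"] Suc
    by (simp add: word_sum_def)
qed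

text \<open>The recursion defining the inverse becomes a Cauchy product under abelianization. Every
  summand contains a coefficient of positive degree of the abelianized \<open>\<phi>\<close>, which
  is 0.\<close>

lemma nc_inverse_abelianize:
  assumes "group_like \<phi>" "\<phi> [A] = 0" "\<phi> [B] = 0"
  shows "word_sum n (\<lambda>w. nc_inverse \<phi> w * abelianize \<alpha> \<beta> w) = of_bool (n = 0)"
proof (cases n)
  case 0
  then show ?thesis by (simp add: word_sum_0 abelianize_def)
next
  case (Suc k)
  define F where "F w = \<phi> w * abelianize \<alpha> \<beta> w" for w
  define G where "G w = nc_inverse \<phi> w * abelianize \<alpha> \<beta> w" for w
  have split: "abelianize \<alpha> \<beta> w = abelianize \<alpha> \<beta> (take j w) * abelianize \<alpha> \<beta> (drop j w)" for w j
    unfolding abelianize_def by (metis append_take_drop_id map_append prod_list.append)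
  have G_Cons: "G (a # w) = - (\<Sum>j\<le>length w. F (a # take j w) * G (drop j w))" for a w
  proof -
    have "abelianize \<alpha> \<beta> (a # w)
        = abelianize \<alpha> \<beta> (a # take j w) * abelianize \<alpha> \<beta> (drop j w)" for j
      using split[of "a # w" "Suc j"] by simp
    then have "(\<phi> (a # take j w) * nc_inverse \<phi> (drop j w)) * abelianize \<alpha> \<beta> (a # w)
        = F (a # take j w) * G (drop j w)" for j
      unfolding F_def G_def by simp
    then show ?thesis
      unfolding G_def[of "a # w"] nc_inverse.simps mult_minus_left sum_distrib_right by simp
  qed
  have "word_sum n G = word_sum k (\<lambda>w. G (A # w) + G (B # w))"
    using Suc by (simp add: word_sum_Suc)
  also have "\<dots> = word_sum k (\<lambda>w. (-1) * (\<Sum>j\<le>k. (F (A # take j w) + F (B # take j w)) * G (drop j w)))"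
    by (rule word_sum_cong) (simp only: G_Cons, simp add: distrib_right sum.distrib)
  also have "\<dots> = - (\<Sum>j\<le>k. word_sum k (\<lambda>w. (F (A # take j w) + F (B # take j w)) * G (drop j w)))"
    unfolding word_sum_const_mult word_sum_sum by simp
  also have "\<dots> = - (\<Sum>j\<le>k. word_sum (Suc j) F * word_sum (k - j) G)"
  proof -
    have "word_sum k (\<lambda>w. (F (A # take j w) + F (B # take j w)) * G (drop j w))
        = word_sum (Suc j) F * word_sum (k - j) G" if "j \<le> k" for j
      using word_sum_split[of j "k - j" "\<lambda>w. F (A # w) + F (B # w)" G] that
      by (simp add: word_sum_Suc)
    then show ?thesis by simp
  qed
  also have "\<dots> = 0"
    using group_like_abelianize[OF assms, of _ \<alpha> \<beta>] unfolding F_def by simp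
  finally show ?thesis using Suc unfolding G_def by simp
qed

text \<open>A product of chord weights does not see the order of the chords, so \<open>A\<close> and
  \<open>B\<close> are replaced by the commuting total weights of \<open>S\<close> and
  \<open>S'\<close>.\<close>

lemma total_substitute:
  "total (\<lambda>ps. prod_list (map g ps)) (substitute \<phi> S S') n
    = word_sum n (\<lambda>w. \<phi> w * abelianize (\<Sum>x\<leftarrow>S. g x) (\<Sum>x\<leftarrow>S'. g x) w)"
proof -
  have "prod_list (map ((\<lambda>xs. \<Sum>x\<leftarrow>xs. g x) \<circ> case_letter S S') w)
      = abelianize (\<Sum>x\<leftarrow>S. g x) (\<Sum>x\<leftarrow>S'. g x) w" for w
    unfolding abelianize_def
    by (intro arg_cong[where f = prod_list] map_cong refl) (simp split: letter.split)
  then show ?thesis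
    unfolding total_def substitute_def word_sum_def
    by (simp add: sum_list_concat_map comp_def sum_list_const_mult sum_product_lists)
qed

lemma total_exp_chords:
  "total (\<lambda>ps. prod_list (map g ps)) (exp_chords q S) n = (q * (\<Sum>x\<leftarrow>S. g x)) ^ n / fact n"
proof -
  have "total (\<lambda>ps. prod_list (map g ps)) (exp_chords q S) n
      = (\<Sum>ps\<leftarrow>product_lists (replicate n S). q ^ n / fact n * prod_list (map g ps))"
    unfolding total_def exp_chords_def by (simp add: comp_def)
  also have "\<dots> = (q * (\<Sum>x\<leftarrow>S. g x)) ^ n / fact n"
    unfolding sum_list_const_mult sum_product_lists by (simp add: power_mult_distrib)
  finally show ?thesis .
qed

text \<open>In degree 1 the pentagon is additive in its factors. The chord on strands 0, 1 occurs in
  two factors on the left and one on the right, always in the slot of \<open>A\<close>; the chord on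
  strands 2, 3 likewise, always in the slot of \<open>B\<close>.\<close>

lemma drinfeld_associator_degree_1:
  assumes "drinfeld_associator \<phi>"
  shows "\<phi> [A] = 0" "\<phi> [B] = 0"
proof -
  have unit: "\<phi> [] = 1" using assms unfolding drinfeld_associator_def group_like_def by blast
  let ?F = "substitute \<phi> [(0,1)] [(1,2)] \<odot> substitute \<phi> [(0,1),(0,2)] [(1,3),(2,3)]
          \<odot> substitute \<phi> [(1,2)] [(2,3)]"
  let ?G = "substitute \<phi> [(0,2),(1,2)] [(2,3)] \<odot> substitute \<phi> [(0,1)] [(1,2),(1,3)]"
  define g where "g J hs = (of_bool ((strand_words 4 hs, []) \<in> supported_codes 4 0 J 1) :: rat)" for J hs
  have "horizontal_eq 4 ?F ?G"
    using assms unfolding drinfeld_associator_def by blast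
  then have eq: "total (g J) ?F 1 = total (g J) ?G 1" for J
    unfolding horizontal_eq_def Let_def g_def
    by (drule_tac eq_4T_total[where J = J and n = 1]) (simp only: total_map_series comp_def)
  have lists: "[0..<4] = [0, 1, 2, 3::nat]" by (simp add: upt_rec)
  have all4: "(\<forall>j<4. P j) \<longleftrightarrow> P 0 \<and> P 1 \<and> P 2 \<and> P (3::nat)" for P
    by (auto simp: numeral_eq_Suc less_Suc_eq)
  \<comment> \<open>A single chord puts one endpoint on each of the strands \<open>a\<close> and
    \<open>b\<close>, so it is supported in \<open>J\<close> exactly when both belong to
    \<open>J\<close>.\<close>
  have g: "g J [(a, b)] = of_bool (a \<in> J \<and> b \<in> J)" if "a < b" "b < 4" for J a b
  proof -
    have "b \<in> {1, 2, 3}" "a \<in> {0, 1, 2}" using that by auto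
    then show ?thesis using that
      unfolding g_def supported_codes_def codes_def endpoints_def strand_words_def lists
      by (auto simp: all4)
  qed
  have conv1: "total h (F \<odot> G) 1 = (\<Sum>(c, x)\<leftarrow>F 0. \<Sum>(d, y)\<leftarrow>G 1. c * d * h (x @ y))
      + (\<Sum>(c, x)\<leftarrow>F 1. \<Sum>(d, y)\<leftarrow>G 0. c * d * h (x @ y))" for h F G
    unfolding total_def conv_def by (simp add: sum_list_concat_map split_def comp_def)
  have sub: "substitute \<phi> S S' 0 = [(1, [])]"
    "substitute \<phi> S S' 1 = map (\<lambda>x. (\<phi> [A], [x])) S @ map (\<lambda>x. (\<phi> [B], [x])) S'" for S S'
    unfolding substitute_def by (simp_all add: unit map_concat comp_def)
  \<comment> \<open>Constant terms are 1, so the degree 1 terms of the factors are just collected;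
    those of the right factor stand in front because \<open>conv\<close> lists degree 0 of the left
    factor before degree 1.\<close>
  have conv0: "(substitute \<phi> S S' \<odot> substitute \<phi> T T') 0 = [(1, [])]"
    "(substitute \<phi> S S' \<odot> substitute \<phi> T T') 1 = substitute \<phi> T T' 1 @ substitute \<phi> S S' 1" for S S' T T'
  proof -
    have single: "concat (map (\<lambda>(c, x). [(c, x)]) xs) = xs" for xs :: "(rat \<times> horizontal) list"
      by (induction xs) auto
    show "(substitute \<phi> S S' \<odot> substitute \<phi> T T') 0 = [(1, [])]"
      "(substitute \<phi> S S' \<odot> substitute \<phi> T T') 1 = substitute \<phi> T T' 1 @ substitute \<phi> S S' 1"
      unfolding conv_def using sub by (simp_all add: comp_def single)
  qed
  have "2 * \<phi> [A] = \<phi> [A]"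
    using eq[of "{0, 1}"] unfolding conv1 conv0 sub by (simp add: g)
  then show "\<phi> [A] = 0" by simp
  have "2 * \<phi> [B] = \<phi> [B]"
    using eq[of "{2, 3}"] unfolding conv1 conv0 sub by (simp add: g)
  then show "\<phi> [B] = 0" by simp
qed

section \<open>The value of the unknot\<close>

lemma sum_list_map_uminus:
  "(\<Sum>(c, w)\<leftarrow>map (map_prod uminus id) xs. c * g w) = - (\<Sum>(c, w)\<leftarrow>xs. c * g w)"
  for g :: "'a \<Rightarrow> rat"
  by (induction xs) auto

lemma mset_replace:
  assumes "mset a = mset b" "mset u = mset u'"
  shows "mset (concat (map ((\<lambda>l. [l])(e := u)) a)) = mset (concat (map ((\<lambda>l. [l])(e := u')) b))"
proof -
  have "mset (concat (map f a)) = sum_mset (image_mset (\<lambda>l. mset (f l)) (mset a))"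
    for f :: "'a \<Rightarrow> 'b list" and a
    by (induction a) auto
  moreover have "(\<lambda>l. mset (((\<lambda>l. [l])(e := u)) l)) = (\<lambda>l. mset (((\<lambda>l. [l])(e := u')) l))"
    using assms(2) by (intro ext) simp
  ultimately show ?thesis using assms(1) by metis
qed

text \<open>Expanding a vertex in two rearranged words leaves rearranged words in both branches, so
  the comparison passes through all STU steps.\<close>

lemma total_stu_perm:
  assumes "\<And>v w. mset v = mset w \<Longrightarrow> g v = (g w :: rat)"
  shows "mset a = mset b \<Longrightarrow> (\<Sum>(c, w)\<leftarrow>stu a vs. c * g w) = (\<Sum>(c, w)\<leftarrow>stu b vs. c * g w)"
proof (induction vs arbitrary: a b)
  case Nil
  then show ?case using assms[of a b] by simp
next
  case (Cons v vs)
  obtain e f h where v: "v = (e, f, h)" by (cases v)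
  show ?case unfolding v stu.simps map_append sum_list.append sum_list_map_uminus
    by (intro arg_cong2[where f = "(+)"] arg_cong[where f = uminus] Cons.IH mset_replace
        Cons.prems refl)
qed

text \<open>The first STU step already yields two words that differ by a transposition and carry
  opposite signs; the remaining steps give both the same total.\<close>

lemma total_stu:
  assumes "\<And>v w. mset v = mset w \<Longrightarrow> g v = (g w :: rat)" and "vs \<noteq> []"
  shows "(\<Sum>(c, w)\<leftarrow>stu a vs. c * g w) = 0"
proof -
  obtain e f h us where vs: "vs = (e, f, h) # us"
    using assms(2) by (metis neq_Nil_conv prod_cases3)
  have "mset (concat (map ((\<lambda>l. [l])(e := [f, h])) a))
      = mset (concat (map ((\<lambda>l. [l])(e := [h, f])) a))"
    by (rule mset_replace) simp_all
  then have "(\<Sum>(c, w)\<leftarrow>stu (concat (map ((\<lambda>l. [l])(e := [f, h])) a)) us. c * g w)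
      = (\<Sum>(c, w)\<leftarrow>stu (concat (map ((\<lambda>l. [l])(e := [h, f])) a)) us. c * g w)"
    by (rule total_stu_perm[rotated]) (rule assms(1))
  then show ?thesis
    unfolding vs stu.simps map_append sum_list.append sum_list_map_uminus by linarith
qed

text \<open>Without vertices there is one arrangement, the empty word, with coefficient 1; with at
  least one vertex each arrangement contributes 0. The case distinction is on the vertex list, since
  a wheel with 0 legs would have no vertices.\<close>

lemma total_chi_wheels:
  assumes "\<And>v w. mset v = mset w \<Longrightarrow> g v = (g w :: rat)"
  shows "(\<Sum>(c, w)\<leftarrow>chi_wheels ls. c * g w) = (if wheels 0 ls = [] then g [] else 0)"
proof (cases "wheels 0 ls = []")
  case True
  then show ?thesis unfolding chi_wheels_def by simp
next
  case False
  have zero: "(\<Sum>x\<leftarrow>stu a (wheels 0 ls). fst x / d * g (snd x)) = 0" for a d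
  proof -
    have "(\<Sum>x\<leftarrow>stu a (wheels 0 ls). fst x / d * g (snd x))
        = (\<Sum>x\<leftarrow>stu a (wheels 0 ls). 1 / d * (fst x * g (snd x)))"
      by simp
    also have "\<dots> = 1 / d * (\<Sum>(c, w)\<leftarrow>stu a (wheels 0 ls). c * g w)"
      unfolding sum_list_const_mult split_def ..
    finally show ?thesis using total_stu[OF assms False] by simp
  qed
  have "(\<Sum>(c, w)\<leftarrow>chi_wheels ls. c * g w) = 0"
    unfolding chi_wheels_def Let_def split_def
    by (simp only: sum_list_concat_map map_map comp_def fst_conv snd_conv zero) simp
  then show ?thesis using False by simp
qed

text \<open>In degree \<open>n\<close> the numbers of legs add up to \<open>n\<close>, so positive
  degree forces a vertex.\<close>

lemma exp_wheels_nonempty: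
  assumes "(c, ls) \<in> set (exp_wheels n)" "n > 0"
  shows "wheels 0 ls \<noteq> []"
proof -
  have power: "sum_list ls = n" if "(c, ls) \<in> set (wheels_power k n)" for c k n ls
    using that
  proof (induction k arbitrary: c n ls)
    case 0
    then show ?case by (auto split: if_splits)
  next
    case (Suc k)
    then show ?case
      by (auto elim!: conv_elem split: if_splits simp: even_wheels_def)
  qed
  have "wheels z ls \<noteq> []" if "sum_list ls > 0" for z ls
    using that by (induction z ls rule: wheels.induct) auto
  moreover have "sum_list ls = n"
    using assms power unfolding exp_wheels_def by auto
  ultimately show ?thesis using assms by auto
qed

lemma total_nu:
  assumes "\<And>v w. mset v = mset w \<Longrightarrow> g v = g w"
  shows "total g nu n = (if n = 0 then g [] else 0)"
proof -
  have "total g nu n = (\<Sum>(c, ls)\<leftarrow>exp_wheels n. c * (\<Sum>(d, w)\<leftarrow>chi_wheels ls. d * g w))"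
    unfolding total_def nu_def
    by (simp add: sum_list_concat_map comp_def split_def sum_list_const_mult mult.assoc)
  also have "\<dots> = (\<Sum>(c, ls)\<leftarrow>exp_wheels n. c * (if n = 0 \<and> wheels 0 ls = [] then g [] else 0))"
    by (intro arg_cong[where f = sum_list] map_cong refl)
      (use exp_wheels_nonempty in \<open>auto simp: total_chi_wheels[OF assms]\<close>)
  also have "\<dots> = (if n = 0 then g [] else 0)"
    by (cases "n = 0") (auto simp: exp_wheels_def split_def comp_def)
  finally show ?thesis .
qed

text \<open>The bookkeeping behind every product: if factors of degrees \<open>k\<close> and
  \<open>n - k\<close> use the names from 0 upwards, shifting the second by \<open>k\<close> makes
  the product use exactly the names below \<open>n\<close>.\<close>

lemma mset_upt_shift:
  assumes "k \<le> n"
  shows "mset [0..<k] + image_mset (\<lambda>l. l + k) (mset [0..<n - k]) = mset [0..<n]"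
proof -
  have "[0..<n] = [0..<k] @ map (\<lambda>l. l + k) [0..<n - k]"
    using assms upt_add_eq_append[of 0 k "n - k"] map_add_upt[of k "n - k"] by simp
  then show ?thesis by (metis mset_append mset_map)
qed

lemma count_double_upt: "count (mset [0..<n] + mset [0..<n]) l \<in> {0, 2}"
proof -
  have "count (mset [0..<n]) l \<in> {0, 1}"
    by (metis distinct_count_atmost_1 distinct_upt insertCI)
  then show ?thesis by (auto simp del: mset_upt)
qed

text \<open>The generating function of \<open>s\<close> squares to that of \<open>nu\<close>, which
  is 1; with constant term 1 it is itself 1.\<close>

lemma sqrt_nu_total:
  assumes "sqrt_nu s"
  shows "total (\<lambda>_. 1) s n = of_bool (n = 0)"
proof -
  define S where "S k = total (\<lambda>_. 1) s k" for k
  define g where "g k w = (of_bool (([], [w]) \<in> supported_codes 0 1 {0} k) :: rat)" for k w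
  have words: "mset w = mset [0..<n] + mset [0..<n]" if "(c, w) \<in> set (s n)" for n c w
    using assms that unfolding sqrt_nu_def by blast
  have g: "g k w = 1" if "mset w = mset [0..<k] + mset [0..<k]" for k w
  proof -
    show ?thesis using that count_double_upt[of k]
      unfolding g_def supported_codes_iff supported_letters_def by (simp del: mset_upt)
  qed
  have "total (g n) (conv (\<lambda>k v w. v @ map (\<lambda>l. l + k) w) s s) n = (\<Sum>k\<le>n. S k * S (n - k))" for n
    unfolding S_def
  proof (rule total_conv)
    fix k c x d y
    assume k: "k \<le> n" and x: "(c, x) \<in> set (s k)" and y: "(d, y) \<in> set (s (n - k))"
    \<comment> \<open>Each name below \<open>n\<close> occurs twice in the product word, so the word
      is a legal code of degree \<open>n\<close> and the indicator \<open>g n\<close> is 1.\<close>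
    have "mset (x @ map (\<lambda>l. l + k) y) = mset [0..<n] + mset [0..<n]"
      using words[OF x] words[OF y] mset_upt_shift[OF k, symmetric]
      by (simp add: ac_simps del: mset_upt)
    then show "g n (x @ map (\<lambda>l. l + k) y) = 1 * 1"
      using g by simp
  qed
  moreover have "total (g n) (conv (\<lambda>k v w. v @ map (\<lambda>l. l + k) w) s s) n = total (g n) nu n" for n
  proof -
    have "eq_4T 0 1 (coeffs_of (map_series (\<lambda>w. ([], [w])) (conv (\<lambda>k v w. v @ map (\<lambda>l. l + k) w) s s)))
      (coeffs_of (map_series (\<lambda>w. ([], [w])) nu))"
      using assms unfolding sqrt_nu_def Let_def by blast
    from eq_4T_total[OF this, of "{0}" n] show ?thesis
      unfolding total_map_series g_def comp_def .
  qed
  moreover have "total (g n) nu n = of_bool (n = 0)" for n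
  proof -
    have "g n v = g n w" if "mset v = mset w" for v w
      using that unfolding g_def supported_codes_iff by simp
    from total_nu[OF this] show ?thesis using g[of "[]" 0] by simp
  qed
  ultimately have conv: "(\<Sum>k\<le>n. S k * S (n - k)) = of_bool (n = 0)" for n by simp
  have S0: "S 0 = 1"
    using assms unfolding S_def total_def sqrt_nu_def by simp
  have "S n = of_bool (n = 0)"
  proof (induction n rule: less_induct)
    case (less n)
    show ?case
    proof (cases "n = 0")
      case False
      \<comment> \<open>By induction only \<open>k = 0\<close> and \<open>k = n\<close> survive,
        leaving \<open>2 * S n\<close>; this has to vanish for positive \<open>n\<close>.\<close>
      have "(\<Sum>k\<le>n. S k * S (n - k)) = (\<Sum>k\<le>n. if k \<in> {0, n} then S n else 0)"
        by (rule sum.cong) (use False less S0 in auto)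
      also have "\<dots> = (\<Sum>k\<in>{0, n}. S n)"
        by (rule sum.mono_neutral_cong_right) auto
      also have "\<dots> = 2 * S n"
        using False by simp
      finally show ?thesis using conv[of n] False by simp
    qed (simp add: S0)
  qed
  then show ?thesis unfolding S_def .
qed

section \<open>The framing\<close>

definition crossing_sum :: "nat \<Rightarrow> (nat \<times> event) list \<Rightarrow> int" where
  "crossing_sum i gs = (\<Sum>(k, g)\<leftarrow>gs. self_crossing_sign i g)"

lemma crossing_sum_append: "crossing_sum i (u @ v) = crossing_sum i u + crossing_sum i v"
  unfolding crossing_sum_def by simp

text \<open>The framed first move trades curls of equal sign, the second cancels opposite signs, the
  third permutes three crossings. In the slides, reversing one strand and exchanging over and under
  each flip the sign, hence together preserve it.\<close>

lemma framed_move_crossing_sum: "framed_move l r \<Longrightarrow> crossing_sum i l = crossing_sum i r"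
proof (induction rule: framed_move.induct)
  case (in_context l r u v)
  then show ?case by (simp add: crossing_sum_append)
qed (auto simp: crossing_sum_def opp_def)

lemma isotopy_writhe:
  assumes "(S, T) \<in> isotopy m"
  shows "writhe i S = writhe i T"
proof -
  have writhe_step: "writhe i S = writhe i T"
    if "slices 0 S = slices 0 T \<or> framed_move (slices 0 S) (slices 0 T)" for S T
    using that framed_move_crossing_sum[of "slices 0 S" "slices 0 T" i]
    unfolding writhe_def crossing_sum_def by metis
  show ?thesis using assms unfolding isotopy_def Let_def
  proof (induction rule: rtrancl_induct)
    case (step T U)
    from step.hyps(2) have "(slices 0 T = slices 0 U \<or> framed_move (slices 0 T) (slices 0 U))
        \<or> (slices 0 U = slices 0 T \<or> framed_move (slices 0 U) (slices 0 T))"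
      by auto
    then have "writhe i T = writhe i U"
      using writhe_step[of T U] writhe_step[of U T] by argo
    then show ?case using step.IH by simp
  qed simp
qed

lemma framed_links_cases:
  assumes "L \<in> framed_links m"
  obtains S where "S \<in> link_words m" "L = isotopy m `` {S}"
  using assms unfolding framed_links_def quotient_def by blast

text \<open>Justifies the definite description in \<open>framing\<close>: the writhe is constant on
  the class, and the class is inhabited by \<open>T\<close>.\<close>

lemma framing_eq_writhe:
  assumes "L \<in> framed_links m" "T \<in> L"
  shows "framing i L = writhe i T"
proof -
  obtain S where L: "L = isotopy m `` {S}"
    using framed_links_cases[OF assms(1)] .
  have S: "writhe i T' = writhe i S" if "T' \<in> L" for T'
    using isotopy_writhe[of S T' m i] that L by simp
  show ?thesis unfolding framing_def
  proof (rule the_equality)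
    show "\<forall>T'\<in>L. writhe i T' = writhe i T"
      using S assms(2) by metis
    show "z = writhe i T" if "\<forall>T'\<in>L. writhe i T' = z" for z
      using that assms(2) by metis
  qed
qed

lemma framed_links_link_words:
  assumes "L \<in> framed_links m" "T \<in> L"
  shows "T \<in> link_words m"
proof -
  obtain S where S: "S \<in> link_words m" "L = isotopy m `` {S}"
    using framed_links_cases[OF assms(1)] .
  then have "(S, T) \<in> isotopy m" using assms(2) by blast
  then show ?thesis unfolding isotopy_def Let_def
  proof (cases rule: rtranclE)
    case base
    then show ?thesis using S(1) by simp
  next
    case (step U)
    from step(2) show ?thesis by auto
  qed
qed


section \<open>Gluing of diagrams\<close>

text \<open>The component number is kept beside the place, so that equality of boundaries also
  guarantees that glued arcs belong to the same component.\<close>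

definition starts :: "arc list \<Rightarrow> (place \<times> nat) multiset" where
  "starts as = mset (map (\<lambda>(c, a, w, b). (a, c)) as)"

definition ends :: "arc list \<Rightarrow> (place \<times> nat) multiset" where
  "ends as = mset (map (\<lambda>(c, a, w, b). (b, c)) as)"

text \<open>Two choices of \<open>J\<close> matter: \<open>UNIV\<close> gives all chord names, and
  the complement of \<open>{i}\<close> detects endpoints away from component
  \<open>i\<close>.\<close>

definition letters :: "nat set \<Rightarrow> tdiagram \<Rightarrow> nat multiset" where
  "letters J d = (\<Sum>(c, a, w, b)\<leftarrow>fst d. if c \<in> J then mset w else {#})
     + (\<Sum>(c, w)\<leftarrow>snd d. if c \<in> J then mset w else {#})"

text \<open>Allows a term to be compared with \<open>skeleton\<close>, through which
  \<open>link_words\<close> prescribes the circles.\<close>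

definition erase :: "tdiagram \<Rightarrow> tdiagram" where
  "erase d = (map (\<lambda>(c, a, w, b). (c, a, [], b)) (fst d), map (\<lambda>(c, w). (c, [])) (snd d))"

lemma starts_simps [simp]:
  "starts [] = {#}" "starts ((c, a, w, b) # as) = add_mset (a, c) (starts as)"
  "starts (as @ as') = starts as + starts as'"
  unfolding starts_def by simp_all

lemma ends_simps [simp]:
  "ends [] = {#}" "ends ((c, a, w, b) # as) = add_mset (b, c) (ends as)"
  "ends (as @ as') = ends as + ends as'"
  unfolding ends_def by simp_all

lemma mset_arcs_cong:
  assumes "mset as = mset as'"
  shows "starts as = starts as'" "ends as = ends as'" "letters J (as, cs) = letters J (as', cs)"
proof -
  show "starts as = starts as'" "ends as = ends as'"
    unfolding starts_def ends_def mset_map assms by (rule refl)+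
  have "(\<Sum>x\<leftarrow>xs. f x) = sum_mset (image_mset f (mset xs))"
    for f :: "arc \<Rightarrow> nat multiset" and xs
    by (induction xs) auto
  then show "letters J (as, cs) = letters J (as', cs)"
    unfolding letters_def fst_conv snd_conv by (simp only: assms)
qed

lemma map_remove1:
  assumes "\<And>z. z \<in> set xs \<Longrightarrow> f z = f x \<Longrightarrow> z = x"
  shows "map f (remove1 x xs) = remove1 (f x) (map f xs)"
  using assms
proof (induction xs)
  case (Cons y xs)
  have "y = x" if "f y = f x" using Cons.prems[of y] that by simp
  moreover have "map f (remove1 x xs) = remove1 (f x) (map f xs)"
    using Cons by simp
  ultimately show ?case by (cases "y = x") auto
qed simp

text \<open>Ensures that \<open>hd\<close> in \<open>join\<close> picks a uniquely determined arc
  and never an unspecified value.\<close>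

lemma filter_eq_singleton:
  assumes "mset (map f xs) = add_mset (q, c) M" "q \<notin> fst ` set_mset M"
  obtains x where "filter (\<lambda>x. fst (f x) = q) xs = [x]" "f x = (q, c)"
proof -
  have "set_mset (filter_mset (\<lambda>p. fst p = q) M) = {}"
    using assms(2) by force
  then have "filter_mset (\<lambda>p. fst p = q) M = {#}"
    unfolding set_mset_eq_empty_iff .
  then have "mset (filter (\<lambda>p. fst p = q) (map f xs)) = {#(q, c)#}"
    unfolding mset_filter assms(1) by simp
  then have "map f (filter (\<lambda>x. fst (f x) = q) xs) = [(q, c)]"
    unfolding filter_map comp_def mset_single_iff .
  then show ?thesis using that by (auto simp: map_eq_Cons_conv)
qed

text \<open>One arc ends at the glued point and one starts there. If they coincide the arc closes up
  to a circle, otherwise the two are concatenated. The arcs are identified by their endpoints, which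
  \<open>erase\<close> keeps, so erasing first leads to the same case and the same choice.\<close>

lemma join_cases:
  assumes "starts as = add_mset (Mid k, c) M" "ends as = add_mset (Mid k, c) N"
    and "Mid k \<notin> fst ` set_mset M" "Mid k \<notin> fst ` set_mset N"
  obtains (circle) v where "(c, Mid k, v, Mid k) \<in> set as"
      "join k (as, cs) = (remove1 (c, Mid k, v, Mid k) as, (c, v) # cs)"
      "join k (erase (as, cs)) = erase (join k (as, cs))"
  | (arc) a v w b as' where "mset as = {#(c, a, v, Mid k), (c, Mid k, w, b)#} + mset as'"
      "join k (as, cs) = ((c, a, v @ w, b) # as', cs)"
      "join k (erase (as, cs)) = erase (join k (as, cs))"
proof -
  let ?e = "\<lambda>(c, a, w, b). (c, a, [] :: nat list, b)"
  let ?in = "\<lambda>x::arc. case x of (c, a, w, b) \<Rightarrow> b = Mid k"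
  let ?out = "\<lambda>x::arc. case x of (c, a, w, b) \<Rightarrow> a = Mid k"
  obtain x where x: "filter (\<lambda>x. fst ((\<lambda>(c, a, w, b). (b, c)) x) = Mid k) as = [x]"
    "(\<lambda>(c, a, w, b). (b, c)) x = (Mid k, c)"
    using filter_eq_singleton[OF assms(2)[unfolded ends_def] assms(4)] .
  obtain y where y: "filter (\<lambda>x. fst ((\<lambda>(c, a, w, b). (a, c)) x) = Mid k) as = [y]"
    "(\<lambda>(c, a, w, b). (a, c)) y = (Mid k, c)"
    using filter_eq_singleton[OF assms(1)[unfolded starts_def] assms(3)] .
  obtain a v where xa: "x = (c, a, v, Mid k)" using x(2) by (cases x) auto
  obtain w b where yb: "y = (c, Mid k, w, b)" using y(2) by (cases y) auto
  have fx: "filter ?in as = [x]" using x(1) by (simp add: split_def)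
  have fy: "filter ?out as = [y]" using y(1) by (simp add: split_def)
  have ux: "z = x" if "z \<in> set as" "?in z" for z
  proof -
    have "z \<in> set (filter ?in as)" using that by (simp only: set_filter mem_Collect_eq)
    then show ?thesis unfolding fx by simp
  qed
  have uy: "z = y" if "z \<in> set as" "?out z" for z
  proof -
    have "z \<in> set (filter ?out as)" using that by (simp only: set_filter mem_Collect_eq)
    then show ?thesis unfolding fy by simp
  qed
  have mem: "x \<in> set as" "y \<in> set as"
    using filter_is_subset[of ?in as] filter_is_subset[of ?out as] unfolding fx fy by simp_all
  have ex: "z = x" if "z \<in> set as" "?e z = ?e x" for z
    using ux[OF that(1)] that(2) xa by (cases z) auto
  have ey: "z = y" if "z \<in> set as" "?e z = ?e y" for z
    using uy[OF that(1)] that(2) yb by (cases z) auto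
  have fex: "filter ?in (map ?e as) = [?e x]"
  proof -
    have "filter ?in (map ?e as) = map ?e (filter ?in as)" by (induction as) auto
    then show ?thesis unfolding fx by simp
  qed
  have fey: "filter ?out (map ?e as) = [?e y]"
  proof -
    have "filter ?out (map ?e as) = map ?e (filter ?out as)" by (induction as) auto
    then show ?thesis unfolding fy by simp
  qed
  have rem_y: "map ?e (remove1 y as) = remove1 (?e y) (map ?e as)"
    by (rule map_remove1) (rule ey)
  show ?thesis
  proof (cases "x = y")
    case True
    then have y': "y = (c, Mid k, v, Mid k)" using xa yb by simp
    have j: "join k (as, cs) = (remove1 y as, (c, v) # cs)"
      unfolding join.simps fx fy using True y' by (simp add: Let_def)
    have "join k (erase (as, cs)) = (remove1 (?e y) (map ?e as), (c, []) # map (\<lambda>(c, w). (c, [])) cs)"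
      unfolding erase_def fst_conv snd_conv join.simps fex fey using True y' by (simp add: Let_def)
    also have "\<dots> = erase (join k (as, cs))"
      unfolding j unfolding erase_def fst_conv snd_conv rem_y by simp
    finally show ?thesis using circle mem(2) j y' by blast
  next
    case False
    \<comment> \<open>\<open>join\<close> compares whole arcs, so it must be excluded that distinct
      arcs become equal once their words are erased.\<close>
    have nexy: "?e x \<noteq> ?e y" using ex[OF mem(2)] False by metis
    have xy: "x \<in> set (remove1 y as)" using mem False by simp
    have j: "join k (as, cs) = ((c, a, v @ w, b) # remove1 x (remove1 y as), cs)"
      unfolding join.simps fx fy using False xa yb by (simp add: Let_def)
    have "join k (erase (as, cs)) = ((c, a, [], b) # remove1 (?e x) (remove1 (?e y) (map ?e as)),
        map (\<lambda>(c, w). (c, [])) cs)"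
      unfolding erase_def fst_conv snd_conv join.simps fex fey using nexy xa yb by (simp add: Let_def)
    also have "remove1 (?e x) (remove1 (?e y) (map ?e as)) = map ?e (remove1 x (remove1 y as))"
    proof -
      have "map ?e (remove1 x (remove1 y as)) = remove1 (?e x) (map ?e (remove1 y as))"
        by (rule map_remove1) (use ex in \<open>meson notin_set_remove1\<close>)
      then show ?thesis unfolding rem_y ..
    qed
    also have "((c, a, [], b) # map ?e (remove1 x (remove1 y as)), map (\<lambda>(c, w). (c, [])) cs)
        = erase (join k (as, cs))"
      unfolding j erase_def by simp
    finally have e: "join k (erase (as, cs)) = erase (join k (as, cs))" .
    have "mset as = add_mset y (mset (remove1 y as))"
      using mem by simp
    moreover have "mset (remove1 y as) = add_mset x (mset (remove1 x (remove1 y as)))"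
      using xy by (metis insert_DiffM mset_remove1 set_mset_mset)
    ultimately have "mset as = {#x, y#} + mset (remove1 x (remove1 y as))"
      by (simp add: add_mset_commute del: mset_remove1)
    then show ?thesis using arc j e xa yb by blast
  qed
qed

lemma join_boundary:
  assumes "starts as = add_mset (Mid k, c) M" "ends as = add_mset (Mid k, c) N"
    and "Mid k \<notin> fst ` set_mset M" "Mid k \<notin> fst ` set_mset N"
  shows "starts (fst (join k (as, cs))) = M \<and> ends (fst (join k (as, cs))) = N
    \<and> (\<forall>J. letters J (join k (as, cs)) = letters J (as, cs))
    \<and> join k (erase (as, cs)) = erase (join k (as, cs))"
  using assms
proof (cases rule: join_cases[where cs = cs])
  case (circle v)
  let ?r = "remove1 (c, Mid k, v, Mid k) as"
  have "mset as = mset ((c, Mid k, v, Mid k) # ?r)"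
    using circle(1) by simp
  note m = mset_arcs_cong[OF this, unfolded starts_simps ends_simps]
  have "starts ?r = M" "ends ?r = N"
    using m(1,2) unfolding assms(1,2) by simp_all
  moreover have "letters J (?r, (c, v) # cs) = letters J (as, cs)" for J
    using m(3)[of J cs] by (simp add: letters_def ac_simps)
  ultimately show ?thesis
    using circle(3) unfolding circle(2) by simp
next
  case (arc a v w b as')
  have "mset as = mset ((c, a, v, Mid k) # (c, Mid k, w, b) # as')"
    using arc(1) by simp
  note m = mset_arcs_cong[OF this, unfolded starts_simps ends_simps]
  have "starts ((c, a, v @ w, b) # as') = M" "ends ((c, a, v @ w, b) # as') = N"
    using m(1,2) unfolding assms(1,2) by (simp_all add: add_mset_commute)
  moreover have "letters J ((c, a, v @ w, b) # as', cs) = letters J (as, cs)" for J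
    using m(3)[of J cs] by (simp add: letters_def ac_simps)
  ultimately show ?thesis
    using arc(3) unfolding arc(2) by simp
qed

text \<open>The invariant is that each point still to be glued occurs once as a start and once as an
  end, with one component number \<open>c j\<close>; \<open>M\<close> and \<open>N\<close> are the
  outer boundary, free of interior points.\<close>

lemma fold_join_boundary:
  assumes "distinct ks"
    and "starts as = M + mset (map (\<lambda>j. (Mid j, c j)) ks)"
    and "ends as = N + mset (map (\<lambda>j. (Mid j, c j)) ks)"
    and "fst ` set_mset M \<inter> range Mid = {}" "fst ` set_mset N \<inter> range Mid = {}"
  shows "starts (fst (fold join ks (as, cs))) = M \<and> ends (fst (fold join ks (as, cs))) = N
    \<and> (\<forall>J. letters J (fold join ks (as, cs)) = letters J (as, cs))
    \<and> fold join ks (erase (as, cs)) = erase (fold join ks (as, cs))"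
  using assms(1-3)
proof (induction ks arbitrary: as cs)
  case (Cons k ks)
  let ?R = "mset (map (\<lambda>j. (Mid j, c j)) ks)"
  obtain as' cs' where j: "join k (as, cs) = (as', cs')" by fastforce
  have R: "Mid k \<notin> fst ` set_mset ?R" using Cons.prems(1) by auto
  have "Mid k \<notin> fst ` set_mset M" "Mid k \<notin> fst ` set_mset N"
    using assms(4,5) by blast+
  then have M: "Mid k \<notin> fst ` set_mset (M + ?R)" and N: "Mid k \<notin> fst ` set_mset (N + ?R)"
    using R unfolding set_mset_union image_Un by blast+
  have s: "starts as = add_mset (Mid k, c k) (M + ?R)" "ends as = add_mset (Mid k, c k) (N + ?R)"
    using Cons.prems by simp_all
  have b: "starts as' = M + ?R" "ends as' = N + ?R" "\<And>J. letters J (as', cs') = letters J (as, cs)"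
    "join k (erase (as, cs)) = erase (as', cs')"
    using join_boundary[OF s M N, of cs] unfolding j fst_conv by blast+
  have "distinct ks" using Cons.prems(1) by simp
  note IH = Cons.IH[OF this b(1,2), of cs']
  show ?case unfolding fold.simps comp_apply j b(4) b(3)[symmetric] by (rule IH)
qed simp

section \<open>Boundary points and gluing of tangle diagrams\<close>

fun boundary :: "bool \<Rightarrow> (nat \<Rightarrow> place) \<Rightarrow> point list \<Rightarrow> (place \<times> nat) multiset" where
  "boundary b P [] = {#}"
| "boundary b P (p # ps) =
     (if fst p = b then {#(P 0, snd p)#} else {#}) + boundary b (P \<circ> Suc) ps"

lemma boundary_append:
  "boundary b P (ps @ qs) = boundary b P ps + boundary b (\<lambda>j. P (j + length ps)) qs"
  by (induction ps arbitrary: P) (simp_all add: comp_def)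

lemma image_boundary:
  "image_mset (\<lambda>(a, c). (g a, c)) (boundary b P ps) = boundary b (\<lambda>j. g (P j)) ps"
  by (induction ps arbitrary: P) (simp_all add: comp_def)

lemma boundary_places: "fst ` set_mset (boundary b P ps) \<subseteq> range P"
proof (induction ps arbitrary: P)
  case (Cons p ps)
  have "range (P \<circ> Suc) \<subseteq> range P" by auto
  then have "fst ` set_mset (boundary b (P \<circ> Suc) ps) \<subseteq> range P"
    using Cons.IH by blast
  then show ?case by auto
qed simp

lemma boundary_split:
  "mset (map (\<lambda>j. (if fst (ps ! j) = b then P j else Q j, snd (ps ! j))) [0..<length ps])
    = boundary b P ps + boundary (\<not> b) Q ps"
proof (induction ps arbitrary: P Q)
  case (Cons p ps)
  have "[0..<length (p # ps)] = 0 # map Suc [0..<length ps]"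
    by (simp add: map_Suc_upt upt_conv_Cons del: upt_Suc)
  then show ?case
    using Cons.IH[of "P \<circ> Suc" "Q \<circ> Suc", unfolded comp_def]
    by (simp add: comp_def del: mset_map upt_Suc)
qed simp

text \<open>An arc starts at an upward bottom point or a downward top point, and ends at a downward
  bottom point or an upward top point.\<close>

definition spans :: "point list \<Rightarrow> point list \<Rightarrow> tdiagram \<Rightarrow> bool" where
  "spans ps qs d \<longleftrightarrow> starts (fst d) = boundary True Bot ps + boundary False Top qs
     \<and> ends (fst d) = boundary False Bot ps + boundary True Top qs"

lemma starts_map_tdiagram:
  "starts (fst (map_tdiagram g h d)) = image_mset (\<lambda>(a, c). (g a, c)) (starts (fst d))"
  "ends (fst (map_tdiagram g h d)) = image_mset (\<lambda>(a, c). (g a, c)) (ends (fst d))"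
  unfolding starts_def ends_def map_tdiagram_def
  by (simp_all add: image_mset.compositionality comp_def split_def)

lemma letters_map_tdiagram: "letters J (map_tdiagram g h d) = image_mset h (letters J d)"
proof -
  have "(\<Sum>(c, a, w, b)\<leftarrow>map (\<lambda>(c, a, w, b). (c, g a, map h w, g b)) as. if c \<in> J then mset w else {#})
      = image_mset h (\<Sum>(c, a, w, b)\<leftarrow>as. if c \<in> J then mset w else {#})" for as
    by (induction as) auto
  moreover have "(\<Sum>(c, w)\<leftarrow>map (map_prod id (map h)) cs. if c \<in> J then mset w else {#})
      = image_mset h (\<Sum>(c, w)\<leftarrow>cs. if c \<in> J then mset w else {#})" for cs
    by (induction cs) auto
  ultimately show ?thesis unfolding letters_def map_tdiagram_def by simp
qed

text \<open>The renaming \<open>h'\<close> on the right is free because no names are left; this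
  reconciles the shift by \<open>k\<close> in a product with the shift by 0 in
  \<open>skeleton\<close>.\<close>

lemma erase_map_tdiagram: "erase (map_tdiagram g h d) = map_tdiagram g h' (erase d)"
  unfolding erase_def map_tdiagram_def by (cases d) auto

lemma letters_append:
  "letters J (as @ as', cs @ cs') = letters J (as, cs) + letters J (as', cs')"
  unfolding letters_def by (simp add: ac_simps)

lemma erase_append:
  "erase (as @ as', cs @ cs') = (fst (erase (as, cs)) @ fst (erase (as', cs')),
     snd (erase (as, cs)) @ snd (erase (as', cs')))"
  unfolding erase_def by simp


text \<open>An upward middle point is an end of the lower diagram and a start of the upper one, a
  downward point the reverse. So all middle points occur exactly once among the starts and once
  among the ends, as gluing requires.\<close>

lemma spans_comp_tdiagram:
  fixes k :: nat
  assumes "spans ps qs d" "spans qs rs e"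
  defines "f \<equiv> comp_tdiagram (length qs) k d e"
  shows "spans ps rs f"
    and "letters J f = letters J d + image_mset (\<lambda>l. l + k) (letters J e)"
    and "erase f = comp_tdiagram (length qs) 0 (erase d) (erase e)"
proof -
  obtain as cs where d': "map_tdiagram (case_place Bot Mid Mid) id d = (as, cs)" by fastforce
  obtain as' cs' where e': "map_tdiagram (case_place Mid Top Mid) (\<lambda>l. l + k) e = (as', cs')"
    by fastforce
  let ?mid = "mset (map (\<lambda>j. (Mid j, snd (qs ! j))) [0..<length qs])"
  have mid: "boundary True Mid qs + boundary False Mid qs = ?mid"
    using boundary_split[of qs True Mid Mid] by simp
  have as: "starts as = boundary True Bot ps + boundary False Mid qs"
    "ends as = boundary False Bot ps + boundary True Mid qs"
    using starts_map_tdiagram[of "case_place Bot Mid Mid" id d] assms(1)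
    unfolding d' fst_conv spans_def by (simp_all add: image_boundary)
  have as': "starts as' = boundary True Mid qs + boundary False Top rs"
    "ends as' = boundary False Mid qs + boundary True Top rs"
    using starts_map_tdiagram[of "case_place Mid Top Mid" "\<lambda>l. l + k" e] assms(2)
    unfolding e' fst_conv spans_def by (simp_all add: image_boundary)
  have s: "starts (as @ as') = (boundary True Bot ps + boundary False Top rs) + ?mid"
    "ends (as @ as') = (boundary False Bot ps + boundary True Top rs) + ?mid"
    unfolding starts_simps ends_simps as as' mid[symmetric] by (simp_all add: ac_simps)
  have disj: "fst ` set_mset (boundary b Bot ps + boundary b' Top rs) \<inter> range Mid = {}" for b b'
  proof -
    have disjoint: "(X \<union> Y) \<inter> V = {}" if "X \<subseteq> R" "Y \<subseteq> S" "R \<inter> V = {}" "S \<inter> V = {}"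
      for X Y R S V :: "place set"
      using that by blast
    show ?thesis unfolding set_mset_union image_Un
      by (rule disjoint[OF boundary_places boundary_places]) auto
  qed
  have f: "f = fold join [0..<length qs] (as @ as', cs @ cs')"
    unfolding f_def comp_tdiagram_def d' e' by simp
  note J = fold_join_boundary[OF distinct_upt s disj disj, of "cs @ cs'", folded f]
  show "spans ps rs f" unfolding spans_def using J by simp
  have "letters J f = letters J (as, cs) + letters J (as', cs')"
    using J letters_append[of J as as' cs cs'] by simp
  then show "letters J f = letters J d + image_mset (\<lambda>l. l + k) (letters J e)"
    unfolding d'[symmetric] e'[symmetric] letters_map_tdiagram by simp
  have "comp_tdiagram (length qs) 0 (erase d) (erase e)
      = fold join [0..<length qs] (erase (as @ as', cs @ cs'))"
    unfolding comp_tdiagram_def erase_append split_def Let_def d'[symmetric] e'[symmetric]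
      erase_map_tdiagram[of "case_place Bot Mid Mid" id d id]
      erase_map_tdiagram[of "case_place Mid Top Mid" "\<lambda>l. l + k" e "\<lambda>l. l + 0"] ..
  then show "erase f = comp_tdiagram (length qs) 0 (erase d) (erase e)"
    using J by simp
qed

lemma spans_juxt_tdiagram:
  fixes k :: nat
  assumes "spans ps qs d" "spans ps' qs' e"
  defines "f \<equiv> juxt_tdiagram (length ps) (length qs) k d e"
  shows "spans (ps @ ps') (qs @ qs') f"
    and "letters J f = letters J d + image_mset (\<lambda>l. l + k) (letters J e)"
    and "erase f = juxt_tdiagram (length ps) (length qs) 0 (erase d) (erase e)"
proof -
  let ?g = "case_place (\<lambda>j. Bot (j + length ps)) (\<lambda>j. Top (j + length qs)) Mid"
  obtain as cs where d: "d = (as, cs)" by fastforce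
  obtain as' cs' where e': "map_tdiagram ?g (\<lambda>l. l + k) e = (as', cs')" by fastforce
  have as': "starts as' = boundary True (\<lambda>j. Bot (j + length ps)) ps' + boundary False (\<lambda>j. Top (j + length qs)) qs'"
    "ends as' = boundary False (\<lambda>j. Bot (j + length ps)) ps' + boundary True (\<lambda>j. Top (j + length qs)) qs'"
    using starts_map_tdiagram[of ?g "\<lambda>l. l + k" e] assms(2)
    unfolding e' fst_conv spans_def by (simp_all add: image_boundary)
  have f: "f = (as @ as', cs @ cs')"
    unfolding f_def juxt_tdiagram_def d e' by simp
  show "spans (ps @ ps') (qs @ qs') f"
    using assms(1) unfolding spans_def f d fst_conv starts_simps ends_simps as' boundary_append
    by (simp add: ac_simps)
  show "letters J f = letters J d + image_mset (\<lambda>l. l + k) (letters J e)"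
    unfolding f letters_append d[symmetric] e'[symmetric] letters_map_tdiagram ..
  show "erase f = juxt_tdiagram (length ps) (length qs) 0 (erase d) (erase e)"
    unfolding f erase_append juxt_tdiagram_def split_def Let_def d[symmetric] e'[symmetric]
      erase_map_tdiagram[of ?g "\<lambda>l. l + k" e "\<lambda>l. l + 0"] ..
qed


section \<open>The functional on the integral of a word\<close>

text \<open>The factor contributed by one chord endpoint: the reversal sign on component
  \<open>i\<close>, and 0 elsewhere, since an endpoint off component \<open>i\<close> makes the
  functional vanish.\<close>

definition strand_weight :: "nat \<Rightarrow> point \<Rightarrow> rat" where
  "strand_weight i p = (if snd p = i then if fst p then 1 else - 1 else 0)"

definition chord_weight :: "nat \<Rightarrow> point list \<Rightarrow> nat \<times> nat \<Rightarrow> rat" where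
  "chord_weight i ps x = strand_weight i (ps ! fst x) * strand_weight i (ps ! snd x)"

definition on_component :: "nat \<Rightarrow> tdiagram \<Rightarrow> rat" where
  "on_component i d = of_bool (letters (- {i}) d = {#})"

text \<open>The two ends must lie on different strands: \<open>strand_words\<close> would list a
  chord with both ends on one strand only once.\<close>

definition chord_list :: "nat \<Rightarrow> nat \<Rightarrow> horizontal \<Rightarrow> bool" where
  "chord_list N n h \<longleftrightarrow> length h = n \<and> (\<forall>x\<in>set h. fst x \<noteq> snd x \<and> fst x < N \<and> snd x < N)"

lemma strand_words_nth:
  "j < N \<Longrightarrow> strand_words N h ! j = filter (\<lambda>k. j = fst (h ! k) \<or> j = snd (h ! k)) [0..<length h]"
  unfolding strand_words_def by simp

lemma length_strand_words:
  assumes "j < N"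
  shows "length (strand_words N h ! j) = length (filter (\<lambda>x. j = fst x \<or> j = snd x) h)"
proof -
  have "length (filter (\<lambda>x. j = fst x \<or> j = snd x) (map ((!) h) [0..<length h]))
      = length (filter (\<lambda>k. j = fst (h ! k) \<or> j = snd (h ! k)) [0..<length h])"
    by (simp only: filter_map length_map comp_def)
  then show ?thesis unfolding strand_words_nth[OF assms] map_nth by (rule sym)
qed

lemma sum_mset_pair:
  fixes N :: nat
  assumes "a \<noteq> b" "a < N" "b < N"
  shows "(\<Sum>j<N. if j = a \<or> j = b then X else {#}) = X + (X :: 'a multiset)"
proof -
  have "(\<Sum>j<N. if j \<in> {a, b} then X else {#}) = (\<Sum>j\<in>{..<N} \<inter> {a, b}. X)"
    by (rule sum.inter_restrict[OF finite_lessThan, symmetric])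
  also have "{..<N} \<inter> {a, b} = {a, b}" using assms by auto
  also have "(\<Sum>j\<in>{a, b}. X) = X + X" using assms(1) by simp
  finally show ?thesis by simp
qed

lemma prod_pair:
  fixes N :: nat
  assumes "a \<noteq> b" "a < N" "b < N"
  shows "(\<Prod>j<N. if j = a \<or> j = b then g j else 1) = g a * (g b :: rat)"
proof -
  have "(\<Prod>j<N. if j \<in> {a, b} then g j else 1) = (\<Prod>j\<in>{..<N} \<inter> {a, b}. g j)"
    by (rule prod.inter_restrict[OF finite_lessThan, symmetric])
  also have "{..<N} \<inter> {a, b} = {a, b}" using assms by auto
  also have "(\<Prod>j\<in>{a, b}. g j) = g a * g b" using assms(1) by simp
  finally show ?thesis by simp
qed

lemma mset_strand_words:
  assumes "chord_list N n h"
  shows "(\<Sum>j<N. mset (strand_words N h ! j)) = mset [0..<n] + mset [0..<n]"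
proof -
  have "(\<Sum>j<N. mset (filter (\<lambda>k. j = fst (h ! k) \<or> j = snd (h ! k)) ks)) = mset ks + mset ks"
    if "\<forall>k\<in>set ks. k < n" for ks
    using that
  proof (induction ks)
    case (Cons k ks)
    have k: "fst (h ! k) \<noteq> snd (h ! k)" "fst (h ! k) < N" "snd (h ! k) < N"
      using assms Cons.prems unfolding chord_list_def by auto
    have "mset (filter (\<lambda>k. j = fst (h ! k) \<or> j = snd (h ! k)) (k # ks))
        = (if j = fst (h ! k) \<or> j = snd (h ! k) then {#k#} else {#})
          + mset (filter (\<lambda>k. j = fst (h ! k) \<or> j = snd (h ! k)) ks)" for j
      by simp
    then have "(\<Sum>j<N. mset (filter (\<lambda>k. j = fst (h ! k) \<or> j = snd (h ! k)) (k # ks)))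
        = ({#k#} + {#k#}) + (\<Sum>j<N. mset (filter (\<lambda>k. j = fst (h ! k) \<or> j = snd (h ! k)) ks))"
      by (simp only: sum.distrib sum_mset_pair[OF k])
    also have "(\<Sum>j<N. mset (filter (\<lambda>k. j = fst (h ! k) \<or> j = snd (h ! k)) ks)) = mset ks + mset ks"
      by (rule Cons.IH) (use Cons.prems in simp)
    finally show ?case by simp
  qed simp
  from this[of "[0..<n]"] show ?thesis
    using assms unfolding chord_list_def
    by (auto simp: strand_words_nth simp del: mset_upt mset_filter)
qed

text \<open>The product over all endpoints, grouped by strands on the left and by chords on the
  right.\<close>

lemma prod_strand_weights:
  assumes "chord_list (length ps) n h"
  shows "(\<Prod>j<length ps. strand_weight i (ps ! j) ^ length (strand_words (length ps) h ! j))
    = prod_list (map (chord_weight i ps) h)"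
proof -
  let ?e = "\<lambda>j. strand_weight i (ps ! j)"
  let ?l = "\<lambda>h j. length (filter (\<lambda>x. j = fst x \<or> j = snd x) h)"
  have "(\<Prod>j<length ps. ?e j ^ ?l h j) = prod_list (map (chord_weight i ps) h)"
    if "\<forall>x\<in>set h. fst x \<noteq> snd x \<and> fst x < length ps \<and> snd x < length ps" for h
    using that
  proof (induction h)
    case (Cons x h)
    have "?e j ^ ?l (x # h) j = (if j = fst x \<or> j = snd x then ?e j else 1) * ?e j ^ ?l h j" for j
      by simp
    then have "(\<Prod>j<length ps. ?e j ^ ?l (x # h) j)
        = (\<Prod>j<length ps. if j = fst x \<or> j = snd x then ?e j else 1) * (\<Prod>j<length ps. ?e j ^ ?l h j)"
      by (simp only: prod.distrib)
    also have "(\<Prod>j<length ps. if j = fst x \<or> j = snd x then ?e j else 1) = chord_weight i ps x"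
      unfolding chord_weight_def by (rule prod_pair) (use Cons.prems in simp_all)
    finally show ?case using Cons by simp
  qed simp
  then show ?thesis using assms unfolding chord_list_def by (simp add: length_strand_words)
qed

lemma oriented_case:
  "(case oriented b c a w a' of (c, a, w, a') \<Rightarrow> if c \<in> J then mset w else {#})
    = (if c \<in> J then mset w else {#})"
  unfolding oriented_def by simp

lemma letters_on_strands:
  "letters J (snd (on_strands ps \<pi> ws)) = (\<Sum>j<length ps. if snd (ps ! j) \<in> J then mset (ws ! j) else {#})"
  unfolding letters_def on_strands_def
  by (simp add: comp_def oriented_case interv_sum_list_conv_sum_set_nat atLeast0LessThan)

lemma spans_on_strands: "spans ps ps (snd (on_strands ps id ws))"
proof -
  let ?d = "fst (snd (on_strands ps id ws))"
  have "starts ?d = mset (map (\<lambda>j. (if fst (ps ! j) = True then Bot j else Top j, snd (ps ! j))) [0..<length ps])"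
    unfolding starts_def on_strands_def snd_conv fst_conv map_map
    by (intro arg_cong[where f = mset] map_cong refl) (simp add: oriented_def)
  moreover have "ends ?d = mset (map (\<lambda>j. (if fst (ps ! j) = False then Bot j else Top j, snd (ps ! j))) [0..<length ps])"
    unfolding ends_def on_strands_def snd_conv fst_conv map_map
    by (intro arg_cong[where f = mset] map_cong refl) (simp add: oriented_def)
  ultimately show ?thesis
    unfolding spans_def boundary_split by simp
qed

lemma erase_on_strands:
  "erase (snd (on_strands ps \<pi> ws)) = snd (on_strands ps \<pi> (replicate (length ps) []))"
  unfolding erase_def on_strands_def by (auto simp: oriented_def)

text \<open>Reversal sign and indicator both factor over the strands. A strand off component
  \<open>i\<close> contributes a power of 0, which is 1 exactly when its word is empty.\<close>

lemma on_component_on_strands: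
  "fst (on_strands ps \<pi> ws) * on_component i (snd (on_strands ps \<pi> ws))
    = (\<Prod>j<length ps. strand_weight i (ps ! j) ^ length (ws ! j))"
proof -
  have "(\<Sum>j\<in>K. if snd (ps ! j) \<in> - {i} then mset (ws ! j) else {#}) = {#}
      \<longleftrightarrow> (\<forall>j\<in>K. snd (ps ! j) \<noteq> i \<longrightarrow> ws ! j = [])" if "finite K" for K
    using that by (induction K) auto
  then have "on_component i (snd (on_strands ps \<pi> ws))
      = of_bool (\<forall>j\<in>{..<length ps}. snd (ps ! j) \<noteq> i \<longrightarrow> ws ! j = [])"
    unfolding on_component_def letters_on_strands by simp
  also have "\<dots> = (\<Prod>j<length ps. of_bool (snd (ps ! j) \<noteq> i \<longrightarrow> ws ! j = []))"
    by (cases "\<forall>j\<in>{..<length ps}. snd (ps ! j) \<noteq> i \<longrightarrow> ws ! j = []") auto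
  finally have "fst (on_strands ps \<pi> ws) * on_component i (snd (on_strands ps \<pi> ws))
      = (\<Prod>j<length ps. reversal_sign (fst (ps ! j)) (ws ! j)
          * of_bool (snd (ps ! j) \<noteq> i \<longrightarrow> ws ! j = []))"
    unfolding on_strands_def fst_conv by (simp only: prod.distrib)
  also have "\<dots> = (\<Prod>j<length ps. strand_weight i (ps ! j) ^ length (ws ! j))"
    by (rule prod.cong) (auto simp: strand_weight_def reversal_sign_def power_0_left)
  finally show ?thesis .
qed

lemma horizontal_on_elem:
  assumes "(c, d) \<in> set (horizontal_on ps \<pi> F n)"
  obtains c' h where "(c', h) \<in> set (F n)" "d = snd (on_strands ps \<pi> (strand_words (length ps) h))"
  using assms unfolding horizontal_on_def by (auto simp: split_def)

lemma total_horizontal_on: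
  assumes "\<And>c h. (c, h) \<in> set (F n) \<Longrightarrow> chord_list (length ps) n h"
  shows "total (on_component i) (horizontal_on ps \<pi> F) n
    = total (\<lambda>h. prod_list (map (chord_weight i ps) h)) F n"
proof -
  let ?d = "\<lambda>h. on_strands ps \<pi> (strand_words (length ps) h)"
  have "total (on_component i) (horizontal_on ps \<pi> F) n
      = (\<Sum>x\<leftarrow>F n. fst x * fst (?d (snd x)) * on_component i (snd (?d (snd x))))"
    unfolding total_def horizontal_on_def by (simp add: sum_list_concat_map comp_def split_def)
  also have "\<dots> = (\<Sum>x\<leftarrow>F n. fst x * prod_list (map (chord_weight i ps) (snd x)))"
  proof (intro arg_cong[where f = sum_list] map_cong refl)
    fix x assume "x \<in> set (F n)"
    then have "chord_list (length ps) n (snd x)"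
      using assms[of "fst x" "snd x"] by simp
    then show "fst x * fst (?d (snd x)) * on_component i (snd (?d (snd x)))
        = fst x * prod_list (map (chord_weight i ps) (snd x))"
      by (simp only: mult.assoc on_component_on_strands prod_strand_weights)
  qed
  finally show ?thesis unfolding total_def split_def .
qed

lemma product_lists_elem:
  "ps \<in> set (product_lists xss) \<Longrightarrow> length ps = length xss \<and> set ps \<subseteq> (\<Union>xs\<in>set xss. set xs)"
  by (induction xss arbitrary: ps) fastforce+

lemma exp_chords_elem:
  assumes "(c, h) \<in> set (exp_chords q S n)"
  shows "length h = n \<and> set h \<subseteq> set S"
proof -
  have "h \<in> set (product_lists (replicate n S))"
    using assms unfolding exp_chords_def by auto
  moreover have "(\<Union>xs\<in>set (replicate n S). set xs) \<subseteq> set S" by auto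
  ultimately show ?thesis
    using product_lists_elem[of h "replicate n S"] unfolding length_replicate by blast
qed

lemma substitute_elem:
  assumes "(c, h) \<in> set (substitute \<phi> S S' n)"
  shows "length h = n \<and> set h \<subseteq> set S \<union> set S'"
proof -
  obtain w where w: "length w = n" "h \<in> set (product_lists (map (case_letter S S') w))"
    using assms unfolding substitute_def by (auto simp: set_n_lists)
  have "set (case_letter S S' a) \<subseteq> set S \<union> set S'" for a by (cases a) auto
  then show ?thesis using product_lists_elem[OF w(2)] w(1) by fastforce
qed

lemma horizontal_blocks_chord_list:
  assumes "(c, h) \<in> set (horizontal_blocks \<phi> x y z n)"
  shows "chord_list (x + y + z) n h"
  using substitute_elem[OF assms[unfolded horizontal_blocks_def]]
  unfolding chord_list_def chords_between_def by fastforce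

lemma exp_chords_chord_list:
  assumes "(c, h) \<in> set (exp_chords q [(0, 1)] n)"
  shows "chord_list 2 n h"
  using exp_chords_elem[OF assms] unfolding chord_list_def by fastforce

lemma points_juxt: "points (juxt u v) = points u @ points v"
  by (cases u; cases v) auto

section \<open>Invariants of the terms of the integral\<close>

definition full_words :: "nat list series \<Rightarrow> bool" where
  "full_words s \<longleftrightarrow> (\<forall>n. \<forall>(c, w)\<in>set (s n). mset w = mset [0..<n] + mset [0..<n])"

text \<open>The boundary is what makes gluing work, the skeleton determines the circles of a closed
  diagram, and the multiset of names makes the resulting code legal of degree
  \<open>n\<close>.\<close>

definition valid_term :: "qtangle \<Rightarrow> nat \<Rightarrow> tdiagram \<Rightarrow> bool" where
  "valid_term T n d \<longleftrightarrow> spans (points (bot T)) (points (top T)) d \<and> erase d = skeleton T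
     \<and> letters UNIV d = mset [0..<n] + mset [0..<n]"

lemma valid_term_on_strands:
  assumes "chord_list (length ps) n h"
  shows "letters UNIV (snd (on_strands ps \<pi> (strand_words (length ps) h))) = mset [0..<n] + mset [0..<n]"
  unfolding letters_on_strands using mset_strand_words[OF assms] by simp

lemma valid_term_comp:
  assumes "k \<le> n" "valid_term S k d" "valid_term T (n - k) e" "top S = bot T"
  shows "valid_term (Comp S T) n (comp_tdiagram (width (top S)) k d e)"
    and "letters J (comp_tdiagram (width (top S)) k d e)
      = letters J d + image_mset (\<lambda>l. l + k) (letters J e)"
proof -
  have d: "spans (points (bot S)) (points (top S)) d" and e: "spans (points (top S)) (points (top T)) e"
    using assms unfolding valid_term_def by auto
  note c = spans_comp_tdiagram[OF d e, where k = k]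
  show J: "letters J (comp_tdiagram (width (top S)) k d e)
      = letters J d + image_mset (\<lambda>l. l + k) (letters J e)" for J
    by (rule c(2))
  have "letters UNIV (comp_tdiagram (width (top S)) k d e) = mset [0..<n] + mset [0..<n]"
    using assms(2,3) mset_upt_shift[OF assms(1), symmetric] unfolding J valid_term_def
    by (simp add: ac_simps del: mset_upt)
  then show "valid_term (Comp S T) n (comp_tdiagram (width (top S)) k d e)"
    using c(1,3) assms(2,3) unfolding valid_term_def by simp
qed

lemma valid_term_juxt:
  assumes "k \<le> n" "valid_term S k d" "valid_term T (n - k) e"
  shows "valid_term (Juxt S T) n (juxt_tdiagram (width (bot S)) (width (top S)) k d e)"
    and "letters J (juxt_tdiagram (width (bot S)) (width (top S)) k d e)
      = letters J d + image_mset (\<lambda>l. l + k) (letters J e)"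
proof -
  have d: "spans (points (bot S)) (points (top S)) d" and e: "spans (points (bot T)) (points (top T)) e"
    using assms unfolding valid_term_def by auto
  note c = spans_juxt_tdiagram[OF d e, where k = k]
  show J: "letters J (juxt_tdiagram (width (bot S)) (width (top S)) k d e)
      = letters J d + image_mset (\<lambda>l. l + k) (letters J e)" for J
    by (rule c(2))
  have "letters UNIV (juxt_tdiagram (width (bot S)) (width (top S)) k d e) = mset [0..<n] + mset [0..<n]"
    using assms(2,3) mset_upt_shift[OF assms(1), symmetric] unfolding J valid_term_def
    by (simp add: ac_simps del: mset_upt)
  then show "valid_term (Juxt S T) n (juxt_tdiagram (width (bot S)) (width (top S)) k d e)"
    using c(1,3) assms(2,3) unfolding valid_term_def by (simp add: points_juxt)
qed


lemma spans_swap: "spans [p, q] [q, p] (snd (on_strands [p, q] (\<lambda>j. 1 - j) ws))"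
  unfolding spans_def on_strands_def by (auto simp: oriented_def add_mset_commute)

lemma spans_turn:
  "spans [] [p, opp p] ([oriented (\<not> fst p) (snd p) (Top 0) w (Top 1)], [])"
  "spans [p, opp p] [] ([oriented (fst p) (snd p) (Bot 0) w (Bot 1)], [])"
  unfolding spans_def by (auto simp: oriented_def opp_def)

lemma letters_turn:
  "letters J ([oriented b c a w a'], []) = (if c \<in> J then mset w else {#})"
  unfolding letters_def by (simp add: oriented_case)

lemma erase_turn: "erase ([oriented b c a w a'], []) = ([oriented b c a [] a'], [])"
  unfolding erase_def oriented_def by simp

lemma on_turn_elem:
  assumes "(c, d) \<in> set (on_turn b l a a' s n)"
  obtains q w where "(q, w) \<in> set (s n)" "d = ([oriented b l a w a'], [])"
  using assms unfolding on_turn_def by auto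

lemma kontsevich_terms_valid:
  assumes "full_words s"
  shows "wf_qtangle T \<Longrightarrow> (c, d) \<in> set (kontsevich_terms \<phi> s T n) \<Longrightarrow> valid_term T n d"
proof (induction T arbitrary: c d n)
  case (Strand p)
  obtain c' :: rat and h where h: "(c', h) \<in> set (if n = 0 then [(1, [])] else [])"
    "d = snd (on_strands [p] id (strand_words (length [p]) h))"
    using horizontal_on_elem[OF Strand.prems(2)[unfolded kontsevich_terms.simps]] .
  have "chord_list (length [p]) n h"
    using h(1) unfolding chord_list_def by (auto split: if_splits)
  from valid_term_on_strands[OF this, of id] show ?case
    unfolding valid_term_def h(2) erase_on_strands using spans_on_strands[of "[p]"] by simp
next
  case (Cross \<epsilon> p q)
  obtain c' h where h: "(c', h) \<in> set (exp_chords (if \<epsilon> then 1/2 else -1/2) [(0, 1)] n)"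
    "d = snd (on_strands [p, q] (\<lambda>j. 1 - j) (strand_words (length [p, q]) h))"
    using horizontal_on_elem[OF Cross.prems(2)[unfolded kontsevich_terms.simps]] .
  have "chord_list (length [p, q]) n h"
    using exp_chords_chord_list[OF h(1)] by (simp add: numeral_2_eq_2)
  from valid_term_on_strands[OF this, of "\<lambda>j. 1 - j"] show ?case
    unfolding valid_term_def h(2) erase_on_strands using spans_swap[of p q] by simp
next
  case (Cup p)
  obtain q w where w: "(q, w) \<in> set (s n)" "d = ([oriented (\<not> fst p) (snd p) (Top 0) w (Top 1)], [])"
    using on_turn_elem[OF Cup.prems(2)[unfolded kontsevich_terms.simps]] .
  have "mset w = mset [0..<n] + mset [0..<n]"
    using assms w(1) unfolding full_words_def by blast
  then show ?case unfolding valid_term_def w(2) erase_turn letters_turn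
    using spans_turn(1)[of p w] by simp
next
  case (Cap p)
  obtain q w where w: "(q, w) \<in> set (s n)" "d = ([oriented (fst p) (snd p) (Bot 0) w (Bot 1)], [])"
    using on_turn_elem[OF Cap.prems(2)[unfolded kontsevich_terms.simps]] .
  have "mset w = mset [0..<n] + mset [0..<n]"
    using assms w(1) unfolding full_words_def by blast
  then show ?case unfolding valid_term_def w(2) erase_turn letters_turn
    using spans_turn(2)[of p w] by simp
next
  case (Assoc b u v w)
  let ?ps = "points u @ points v @ points w"
  obtain c' h where h: "(c', h) \<in> set (horizontal_blocks (if b then \<phi> else nc_inverse \<phi>)
      (width u) (width v) (width w) n)" "d = snd (on_strands ?ps id (strand_words (length ?ps) h))"
    using horizontal_on_elem[OF Assoc.prems(2)[unfolded kontsevich_terms.simps]] .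
  have "chord_list (length ?ps) n h"
    using horizontal_blocks_chord_list[OF h(1)] by (simp add: add.assoc)
  from valid_term_on_strands[OF this, of id] show ?case
    unfolding valid_term_def h(2) erase_on_strands using spans_on_strands[of ?ps] by simp
next
  case (Juxt S T)
  from Juxt.prems(2)[unfolded kontsevich_terms.simps]
  obtain k c' x d' y where k: "k \<le> n" and x: "(c', x) \<in> set (kontsevich_terms \<phi> s S k)"
    and y: "(d', y) \<in> set (kontsevich_terms \<phi> s T (n - k))"
    and d: "d = juxt_tdiagram (width (bot S)) (width (top S)) k x y"
    by (rule conv_elem)
  have "valid_term S k x" "valid_term T (n - k) y"
    using Juxt.IH(1)[OF _ x] Juxt.IH(2)[OF _ y] Juxt.prems(1) by simp_all
  then show ?case unfolding d by (rule valid_term_juxt(1)[OF k])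
next
  case (Comp S T)
  from Comp.prems(2)[unfolded kontsevich_terms.simps]
  obtain k c' x d' y where k: "k \<le> n" and x: "(c', x) \<in> set (kontsevich_terms \<phi> s S k)"
    and y: "(d', y) \<in> set (kontsevich_terms \<phi> s T (n - k))"
    and d: "d = comp_tdiagram (width (top S)) k x y"
    by (rule conv_elem)
  have "valid_term S k x" "valid_term T (n - k) y" "top S = bot T"
    using Comp.IH(1)[OF _ x] Comp.IH(2)[OF _ y] Comp.prems(1) by simp_all
  then show ?case unfolding d by (rule valid_term_comp(1)[OF k])
qed

text \<open>The identity exp(xt) exp(yt) = exp((x + y)t) in degree \<open>n\<close>.\<close>

lemma binomial_fact_sum:
  "(\<Sum>k\<le>n. x ^ k / fact k * (y ^ (n - k) / fact (n - k))) = (x + y) ^ n / fact n" for x y :: rat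
proof -
  have "x ^ k / fact k * (y ^ (n - k) / fact (n - k)) = of_nat (n choose k) * x ^ k * y ^ (n - k) / fact n"
    if "k \<le> n" for k
    using binomial_fact[OF that, where 'a = rat] by (simp add: field_simps)
  then have "(\<Sum>k\<le>n. x ^ k / fact k * (y ^ (n - k) / fact (n - k)))
      = (\<Sum>k\<le>n. of_nat (n choose k) * x ^ k * y ^ (n - k) / fact n)"
    by (intro sum.cong) simp_all
  then show ?thesis unfolding binomial_ring sum_divide_distrib .
qed

text \<open>A word of degree \<open>n\<close> has \<open>2 * n\<close> endpoints, so reversing a cup
  or cap costs no sign. Off component \<open>i\<close> only degree 0 survives, which is all that the
  total of \<open>s\<close> retains anyway.\<close>

lemma total_on_turn:
  assumes "full_words s" "total (\<lambda>_. 1) s n = of_bool (n = 0)"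
  shows "total (on_component i) (on_turn b c a a' s) n = of_bool (n = 0)"
proof -
  have "total (on_component i) (on_turn b c a a' s) n
      = (\<Sum>x\<leftarrow>s n. fst x * reversal_sign b (snd x) * on_component i ([oriented b c a (snd x) a'], []))"
    unfolding total_def on_turn_def by (simp add: comp_def split_def)
  also have "\<dots> = (\<Sum>x\<leftarrow>s n. fst x * of_bool (c = i \<or> n = 0))"
  proof (intro arg_cong[where f = sum_list] map_cong refl)
    fix x assume "x \<in> set (s n)"
    then have "(fst x, snd x) \<in> set (s n)" by simp
    then have "mset (snd x) = mset [0..<n] + mset [0..<n]"
      using assms(1) unfolding full_words_def by blast
    then have l: "length (snd x) = 2 * n"
      by (metis diff_zero length_upt mult_2 size_mset size_union)
    then have "reversal_sign b (snd x) = 1" unfolding reversal_sign_def by simp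
    moreover have "on_component i ([oriented b c a (snd x) a'], []) = of_bool (c = i \<or> n = 0)"
      using l unfolding on_component_def letters_turn by auto
    ultimately show "fst x * reversal_sign b (snd x) * on_component i ([oriented b c a (snd x) a'], [])
        = fst x * of_bool (c = i \<or> n = 0)" by simp
  qed
  also have "\<dots> = total (\<lambda>_. 1) s n * of_bool (c = i \<or> n = 0)"
    unfolding total_def sum_list_mult_const by (simp add: split_def)
  finally show ?thesis unfolding assms(2) by simp
qed

lemma on_component_add:
  "letters (- {i}) d = letters (- {i}) x + image_mset f (letters (- {i}) y)
    \<Longrightarrow> on_component i d = on_component i x * on_component i y"
  unfolding on_component_def by simp

text \<open>Exponentials multiply as crossing signs add. The offset \<open>k\<close> is arbitrary
  because juxtaposition moves the slices of the right factor, while signs do not depend on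
  positions.\<close>

lemma kontsevich_terms_total:
  assumes "drinfeld_associator \<phi>" "sqrt_nu s"
  shows "wf_qtangle T \<Longrightarrow> total (on_component i) (kontsevich_terms \<phi> s T) n
    = (of_int (crossing_sum i (slices k T)) / 2) ^ n / fact n"
proof -
  have full: "full_words s" using assms(2) unfolding sqrt_nu_def full_words_def by blast
  have zero: "(of_int 0 / 2) ^ n / fact n = (of_bool (n = 0) :: rat)" for n
    by (simp add: power_0_left)
  note turn = total_on_turn[OF full sqrt_nu_total[OF assms(2)]]
  have group: "group_like \<phi>" using assms(1) unfolding drinfeld_associator_def by blast
  note degree_1 = drinfeld_associator_degree_1[OF assms(1)]
  show "wf_qtangle T \<Longrightarrow> ?thesis"
  proof (induction T arbitrary: n k)
    case (Strand p)
    have "total (on_component i) (kontsevich_terms \<phi> s (Strand p)) n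
        = total (\<lambda>h. prod_list (map (chord_weight i [p]) h)) (\<lambda>n. if n = 0 then [(1, [])] else []) n"
      unfolding kontsevich_terms.simps
      by (rule total_horizontal_on) (auto simp: chord_list_def split: if_splits)
    also have "\<dots> = of_bool (n = 0)" unfolding total_def by simp
    finally show ?case unfolding slices.simps crossing_sum_def by (simp only: zero list.map sum_list.Nil)
  next
    case (Cross \<epsilon> p q)
    let ?q = "if \<epsilon> then 1/2 else -1/2 :: rat"
    have "total (on_component i) (kontsevich_terms \<phi> s (Cross \<epsilon> p q)) n
        = total (\<lambda>h. prod_list (map (chord_weight i [p, q]) h)) (exp_chords ?q [(0, 1)]) n"
      unfolding kontsevich_terms.simps
    proof (rule total_horizontal_on)
      fix c h assume "(c, h) \<in> set (exp_chords ?q [(0, 1)] n)"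
      from exp_chords_chord_list[OF this] show "chord_list (length [p, q]) n h"
        by (simp add: numeral_2_eq_2)
    qed
    also have "\<dots> = (?q * chord_weight i [p, q] (0, 1)) ^ n / fact n"
      unfolding total_exp_chords by simp
    \<comment> \<open>The weights of the two strands multiply to 1 for parallel and -1 for opposite
      directions on component \<open>i\<close>, turning the type of the crossing into its
      sign.\<close>
    also have "?q * chord_weight i [p, q] (0, 1) = of_int (crossing_sum i (slices k (Cross \<epsilon> p q))) / 2"
      unfolding chord_weight_def strand_weight_def crossing_sum_def by simp
    finally show ?case .
  next
    case (Cup p)
    show ?case unfolding kontsevich_terms.simps turn slices.simps crossing_sum_def
      using zero[of n] by simp
  next
    case (Cap p)
    show ?case unfolding kontsevich_terms.simps turn slices.simps crossing_sum_def
      using zero[of n] by simp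
  next
    case (Assoc b u v w)
    let ?ps = "points u @ points v @ points w"
    let ?\<psi> = "if b then \<phi> else nc_inverse \<phi>"
    have "total (on_component i) (kontsevich_terms \<phi> s (Assoc b u v w)) n
        = total (\<lambda>h. prod_list (map (chord_weight i ?ps) h))
            (horizontal_blocks ?\<psi> (width u) (width v) (width w)) n"
      unfolding kontsevich_terms.simps
    proof (rule total_horizontal_on)
      fix c h assume "(c, h) \<in> set (horizontal_blocks ?\<psi> (width u) (width v) (width w) n)"
      from horizontal_blocks_chord_list[OF this] show "chord_list (length ?ps) n h"
        by (simp add: add.assoc)
    qed
    also have "\<dots> = of_bool (n = 0)"
      unfolding horizontal_blocks_def total_substitute
      using group_like_abelianize[OF group degree_1] nc_inverse_abelianize[OF group degree_1] by simp
    finally show ?case unfolding slices.simps crossing_sum_def by (simp only: zero list.map sum_list.Nil)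
  next
    case (Juxt S T)
    have wf: "wf_qtangle S" "wf_qtangle T" using Juxt.prems by simp_all
    let ?l = "k + width (top S)"
    have "total (on_component i) (kontsevich_terms \<phi> s (Juxt S T)) n
        = (\<Sum>j\<le>n. total (on_component i) (kontsevich_terms \<phi> s S) j
            * total (on_component i) (kontsevich_terms \<phi> s T) (n - j))"
      unfolding kontsevich_terms.simps
    proof (rule total_conv)
      fix j c x d y
      assume j: "j \<le> n" and x: "(c, x) \<in> set (kontsevich_terms \<phi> s S j)"
        and y: "(d, y) \<in> set (kontsevich_terms \<phi> s T (n - j))"
      show "on_component i (juxt_tdiagram (width (bot S)) (width (top S)) j x y)
          = on_component i x * on_component i y"
        by (rule on_component_add[OF valid_term_juxt(2)[OF j kontsevich_terms_valid[OF full wf(1) x]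
                kontsevich_terms_valid[OF full wf(2) y]]])
    qed
    also have "\<dots> = (of_int (crossing_sum i (slices k S)) / 2
        + of_int (crossing_sum i (slices ?l T)) / 2) ^ n / fact n"
      unfolding Juxt.IH(1)[OF wf(1), of _ k] Juxt.IH(2)[OF wf(2), of _ ?l] by (rule binomial_fact_sum)
    finally show ?case unfolding slices.simps crossing_sum_append
      by (simp only: of_int_add add_divide_distrib)
  next
    case (Comp S T)
    have wf: "wf_qtangle S" "wf_qtangle T" "top S = bot T" using Comp.prems by simp_all
    have "total (on_component i) (kontsevich_terms \<phi> s (Comp S T)) n
        = (\<Sum>j\<le>n. total (on_component i) (kontsevich_terms \<phi> s S) j
            * total (on_component i) (kontsevich_terms \<phi> s T) (n - j))"
      unfolding kontsevich_terms.simps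
    proof (rule total_conv)
      fix j c x d y
      assume j: "j \<le> n" and x: "(c, x) \<in> set (kontsevich_terms \<phi> s S j)"
        and y: "(d, y) \<in> set (kontsevich_terms \<phi> s T (n - j))"
      show "on_component i (comp_tdiagram (width (top S)) j x y)
          = on_component i x * on_component i y"
        by (rule on_component_add[OF valid_term_comp(2)[OF j kontsevich_terms_valid[OF full wf(1) x]
                kontsevich_terms_valid[OF full wf(2) y] wf(3)]])
    qed
    also have "\<dots> = (of_int (crossing_sum i (slices k S)) / 2
        + of_int (crossing_sum i (slices k T)) / 2) ^ n / fact n"
      unfolding Comp.IH(1)[OF wf(1), of _ k] Comp.IH(2)[OF wf(2), of _ k] by (rule binomial_fact_sum)
    finally show ?case unfolding slices.simps crossing_sum_append
      by (simp only: of_int_add add_divide_distrib)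
  qed
qed

section \<open>Closed diagrams\<close>

lemma all_on_circle_eq:
  assumes "i \<ge> 1"
  shows "all_on_circle i n m = diagram ` supported_codes 0 m {i - 1} n"
proof (intro set_eqI iffI)
  fix D assume "D \<in> all_on_circle i n m"
  then obtain x where x: "x \<in> codes 0 m" "D = diagram x" "deg D = n"
    "\<forall>y\<in>D. \<forall>j\<in>{1..m}. j \<noteq> i \<longrightarrow> snd y ! (j - 1) = []"
    unfolding all_on_circle_def chord_diagrams_def by blast
  have "x \<in> D" unfolding x(2) diagram_def using same_diagram_refl by simp
  then have empty: "snd x ! (j - 1) = []" if "j \<in> {1..m}" "j \<noteq> i" for j
    using x(4) that by blast
  \<comment> \<open>\<open>deg\<close> rounds down, so parity is needed to recover the exact number
    \<open>2 * n\<close> of endpoints.\<close>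
  have "even (length (endpoints x))"
  proof -
    have "even (\<Sum>l\<in>set (endpoints x). count_list (endpoints x) l)"
    proof (rule dvd_sum)
      fix l assume "l \<in> set (endpoints x)"
      have "count_list (endpoints x) l \<in> {0, 2}" using x(1) unfolding codes_def by blast
      then show "2 dvd count_list (endpoints x) l" by auto
    qed
    then show ?thesis by (simp add: sum_count_set)
  qed
  then have "length (endpoints x) = 2 * n"
    using x(3) unfolding x(2) deg_diagram by auto
  moreover have "(fst x @ snd x) ! j = []" if "j < 0 + m" "j \<notin> {i - 1}" for j
    using that empty[of "Suc j"] x(1) unfolding codes_def by auto
  ultimately have "x \<in> supported_codes 0 m {i - 1} n"
    using x(1) unfolding supported_codes_def by blast
  then show "D \<in> diagram ` supported_codes 0 m {i - 1} n" unfolding x(2) by simp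
next
  fix D assume "D \<in> diagram ` supported_codes 0 m {i - 1} n"
  then obtain x where x: "x \<in> supported_codes 0 m {i - 1} n" "D = diagram x" by blast
  have "snd y ! (j - 1) = []" if "y \<in> D" "j \<in> {1..m}" "j \<noteq> i" for y j
  proof -
    have y: "y \<in> supported_codes 0 m {i - 1} n"
      using that(1) same_diagram_supported[OF _ x(1)] unfolding x(2) diagram_def by simp
    have "(fst y @ snd y) ! (j - 1) = []"
    proof -
      have "j - 1 < 0 + m" "j - 1 \<notin> {i - 1}" using that(2,3) assms by auto
      then show ?thesis using y unfolding supported_codes_def by blast
    qed
    moreover have "fst y = []" using y unfolding supported_codes_def codes_def by auto
    ultimately show ?thesis by simp
  qed
  moreover have "deg D = n" using x unfolding supported_codes_def by (auto simp: deg_diagram)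
  moreover have "D \<in> chord_diagrams 0 m"
    using x unfolding supported_codes_def chord_diagrams_def by blast
  ultimately show "D \<in> all_on_circle i n m" unfolding all_on_circle_def by blast
qed

lemma sum_list_eq_empty: "sum_list xs = {#} \<longleftrightarrow> (\<forall>x\<in>set xs. x = {#})"
  by (induction xs) auto

text \<open>An empty boundary leaves no arcs, and the skeleton shows that the circles bear each of
  the numbers 1, ..., m once. So \<open>link_code\<close> reads off every circle, and the code and
  the diagram carry the same letters on each component.\<close>

lemma link_code_supported:
  assumes "T \<in> link_words m" "valid_term T n d" "i \<ge> 1"
  shows "of_bool (link_code m d \<in> supported_codes 0 m {i - 1} n) = on_component i d"
proof -
  have T: "bot T = Empty" "top T = Empty" "mset (map fst (snd (skeleton T))) = mset [1..<Suc m]"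
    using assms(1) unfolding link_words_def by blast+
  have d: "spans [] [] d" "erase d = skeleton T" "letters UNIV d = mset [0..<n] + mset [0..<n]"
    using assms(2) unfolding valid_term_def T by simp_all
  define cs where "cs = snd d"
  define W where "W j = the (map_of cs j)" for j
  have arcs: "fst d = []"
    using d(1) unfolding spans_def starts_def by simp
  have "map fst (snd (erase d)) = map fst cs"
    unfolding erase_def cs_def by (simp add: comp_def split_def)
  then have fsts: "mset (map fst cs) = mset [1..<Suc m]"
    using T(3) d(2) by simp
  then have dist: "distinct (map fst cs)"
    by (metis distinct_upt mset_eq_imp_distinct_iff)
  \<comment> \<open>Distinct component numbers make the lookup in \<open>map_of\<close> return the
    word of every circle.\<close>
  have cs: "cs = map (\<lambda>j. (j, W j)) (map fst cs)"
    unfolding map_map by (rule map_idI[symmetric]) (use dist in \<open>auto simp: W_def\<close>)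
  have letters: "letters J d = (\<Sum>j\<leftarrow>[1..<Suc m]. if j \<in> J then mset (W j) else {#})" for J
  proof -
    have perm: "(\<Sum>x\<leftarrow>xs. f x) = sum_mset (image_mset f (mset xs))"
      for f :: "nat \<Rightarrow> nat multiset" and xs
      by (induction xs) auto
    have "letters J d = (\<Sum>(c, w)\<leftarrow>map (\<lambda>j. (j, W j)) (map fst cs). if c \<in> J then mset w else {#})"
      unfolding letters_def arcs cs_def[symmetric] using cs by simp
    also have "\<dots> = (\<Sum>j\<leftarrow>map fst cs. if j \<in> J then mset (W j) else {#})"
      unfolding map_map[of _ "\<lambda>j. (j, W j)"] comp_def prod.case ..
    finally show ?thesis unfolding perm fsts .
  qed
  have code: "link_code m d = ([], map W [1..<Suc m])"
    unfolding link_code_def W_def cs_def by simp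
  have total: "sum_list ([] @ map mset (map W [1..<Suc m])) = mset [0..<n] + mset [0..<n]"
    using letters[of UNIV] d(3) by (simp add: comp_def del: mset_upt upt_Suc)
  have "size (mset [0..<n] + mset [0..<n]) = 2 * n" by simp
  then have "link_code m d \<in> supported_codes 0 m {i - 1} n
      \<longleftrightarrow> (\<forall>j<0 + m. j \<notin> {i - 1} \<longrightarrow> ([] @ map mset (map W [1..<Suc m])) ! j = {#})"
    unfolding supported_codes_iff code fst_conv snd_conv supported_letters_def list.map total
    using count_double_upt[of n] by simp
  also have "\<dots> \<longleftrightarrow> (\<forall>j<m. j \<noteq> i - 1 \<longrightarrow> W (Suc j) = [])"
    by (simp del: upt_Suc)
  \<comment> \<open>Circle number \<open>j + 1\<close> stands at index \<open>j\<close> of the code;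
    \<open>i \<ge> 1\<close> keeps the subtraction in \<open>i - 1\<close> exact.\<close>
  also have "\<dots> \<longleftrightarrow> (\<forall>j\<in>set [1..<Suc m]. j \<noteq> i \<longrightarrow> W j = [])"
  proof -
    have "set [1..<Suc m] = Suc ` {..<m}" 
      by (simp add: image_Suc_lessThan atLeastLessThanSuc_atLeastAtMost del: upt_Suc)
    then show ?thesis using assms(3) by (auto simp del: set_upt)
  qed
  also have "\<dots> \<longleftrightarrow> letters (- {i}) d = {#}"
    unfolding letters sum_list_eq_empty set_map ball_simps(9) by (intro ball_cong refl) auto
  finally show ?thesis unfolding on_component_def by simp
qed

theorem mainTheorem3:
  fixes m i n :: nat and L :: "qtangle set" and \<phi> :: nc_series
    and s :: "nat list series" and Z :: "chord_diagram \<Rightarrow> rat"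
  assumes "m \<ge> 1" and "L \<in> framed_links m" and "1 \<le> i" and "i \<le> m" and "n \<ge> 1"
    and "drinfeld_associator \<phi>" and "sqrt_nu s"
    and "Z \<in> kontsevich \<phi> s m L"
  shows "1 / (fact n * 2 ^ n) * of_int (framing i L) ^ n = (\<Sum>D\<in>all_on_circle i n m. Z D)"
proof -
  obtain T where T: "T \<in> L" "eq_4T 0 m (kontsevich_word \<phi> s m T) Z"
    using assms(8) unfolding kontsevich_def coset_4T_def by blast
  have word: "T \<in> link_words m" using framed_links_link_words[OF assms(2) T(1)] .
  then have wf: "wf_qtangle T" unfolding link_words_def by blast
  have full: "full_words s" using assms(7) unfolding sqrt_nu_def full_words_def by blast
  have "(\<Sum>D\<in>all_on_circle i n m. Z D) = support_functional 0 m {i - 1} n Z"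
    unfolding all_on_circle_eq[OF assms(3)] support_functional_def ..
  \<comment> \<open>\<open>Z\<close> is an arbitrary representative of the class of the integral of
    \<open>T\<close>; passing to the explicit one is where vanishing on the 4T relators
    enters.\<close>
  also have "\<dots> = support_functional 0 m {i - 1} n (kontsevich_word \<phi> s m T)"
    using support_functional_eq_4T[OF T(2)] by simp
  also have "\<dots> = total (on_component i) (kontsevich_terms \<phi> s T) n"
    unfolding kontsevich_word_def support_functional_coeffs_of total_map_series
  proof (rule total_cong)
    fix c d assume "(c, d) \<in> set (kontsevich_terms \<phi> s T n)"
    from link_code_supported[OF word kontsevich_terms_valid[OF full wf this] assms(3)]
    show "((\<lambda>x. of_bool (x \<in> supported_codes 0 m {i - 1} n)) \<circ> link_code m) d = on_component i d"
      unfolding comp_apply .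
  qed
  also have "\<dots> = (of_int (crossing_sum i (slices 0 T)) / 2) ^ n / fact n"
    by (rule kontsevich_terms_total[OF assms(6,7) wf])
  also have "crossing_sum i (slices 0 T) = framing i L"
    unfolding framing_eq_writhe[OF assms(2) T(1)] writhe_def crossing_sum_def ..
  finally show ?thesis by (simp add: power_divide mult.commute)
qed

end
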